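(* Let $B:\mathcal A\to\mathcal A$ be a monad in a 2-category $\mathcal K$, let $\mathcal C$ be a monoidal category (with associativity constraint $\alpha$ and identity unit constraints) together with a faithful quasi-monoidal functor $\mathcal U:\mathcal C\to\mathcal T(\mathcal A,B)$, $\mathcal U(\overline X)=(X,\tau_{B,X})$, and suppose there is a quasi-monoidal functor $\mathcal F:\mathcal C\to\mathcal T(\mathcal A,B)$ that factors through $\mathcal U$; write $\mathcal F(\overline X)=(X,\psi_{B,X})$. The following are equivalent: 1. There is an action $\mathcal C\times{}_B\mathcal K\to{}_B\mathcal K$ of $\mathcal C$ on ${}_B\mathcal K$ given by $(\overline X,M)\mapsto XM$, where $XM$ is a left $B$-module via $(X\times\nu_M)\circ(\psi_{B,X}\times M)$, where the action associativity isomorphism $r_{X,Y,M}:(XY)M\to X(YM)$ (respectively $\rho_{X,Y,M}:X(YM)\to(XY)M$, in place of $r$) satisfies $$r_{X,Y,M}=(X\times Y\times\nu_M)\circ(r_{X,Y,B}\times M)\circ(X\times Y\times\eta_B\times M)$$ for all $\overline X,\overline Y\in\mathcal C$, $M\in{}_B\mathcal K$, and where the unity-action isomorphism is the identity. 2. For all $\overline X,\overline Y\in\mathcal C$ there is an invertible 2-cell $\hat\rho:(X,\psi_{B,X})(Y,\psi_{B,Y})\to(X,\psi_{B,X})(Y,\psi_{B,Y})$ in $\mathrm{EM}^M(\mathcal K)$ such that $\hat\rho$ is a normalized 2-cocycle (respectively, a normalized 2-cocycle in the inverse form) in $\mathrm{EM}^M(\mathcal K)$.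
   Context: Conventions: 1-cells are composed by juxtaposition, $\times$ is horizontal and $\circ$ vertical composition of 2-cells; a 1-cell in a formula stands for its identity 2-cell. ${}_B\mathcal K$ is the category of left $B$-modules $M:\mathcal A'\to\mathcal A$ (any 0-cell $\mathcal A'$; action $\nu_M:BM\to M$ associative and unital) and left $B$-linear 2-cells. $\mathcal T(\mathcal A,B)$ is the strict monoidal category with objects $(X,\psi)$, $X:\mathcal A\to\mathcal A$, $\psi:BX\to XB$, such that $\psi(\mu_B\times X)=(X\times\mu_B)(\psi\times B)(B\times\psi)$, $\psi(\eta_B\times X)=X\times\eta_B$; morphisms $(X,\psi)\to(Y,\psi')$ are 2-cells $\zeta:X\to Y$ with $(\zeta\times B)\psi=\psi'(B\times\zeta)$; the tensor product is $(X,\psi)(Y,\psi')=(XY,(X\times\psi')(\psi\times Y))$. A quasi-monoidal functor preserves tensor products and the unit but is not required to satisfy the monoidal coherence axiom (so $\mathcal U(\overline X\,\overline Y)=(XY,\tau_{B,XY})$, while $\mathcal C$ may have a non-trivial associativity constraint $\alpha:(\overline X\,\overline Y)\overline Z\to\overline X(\overline Y\,\overline Z)$, whose image under $\mathcal U$ is a morphism $\alpha:XYZ\to XYZ$ of $\mathcal T(\mathcal A,B)$). That $\mathcal F$ factors through $\mathcal U$ means that $\mathcal F(\overline X)$ has the same underlying 1-cell $X$ as $\mathcal U(\overline X)$ and that $\mathcal F$ and $\mathcal U$ have the same underlying 2-cell on each morphism. $\mathrm{EM}^M(\mathcal K)$ is the Eilenberg–Moore 2-category for monads: its endo-1-cells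 of $B$ are the objects $(X,\psi)$ above, and a 2-cell $(X,\psi)\to(Y,\psi')$ is a 2-cell $\zeta:X\to YB$ of $\mathcal K$ with $(Y\times\mu_B)(\zeta\times B)\psi=(Y\times\mu_B)(\psi'\times B)(B\times\zeta)$; vertical composition is $\xi\cdot\zeta=(Z\times\mu_B)(\xi\times B)\zeta$. In general, a 2-cocycle in a 2-category is an operator assigning to composable 1-cells $Y,Z$ a 2-cell $\rho_{Y,Z}:YZ\to YZ$, natural in $Y$ and $Z$, with $(X\times\rho_{Y,Z})\rho_{X,YZ}=(\rho_{X,Y}\times Z)\rho_{XY,Z}$; its inverse form is $\rho_{X,YZ}(X\times\rho_{Y,Z})=\rho_{XY,Z}(\rho_{X,Y}\times Z)$; it is normalized if $\rho_{\mathrm{Id},X}=\rho_{X,\mathrm{Id}}=\mathrm{id}_X$. In the present situation condition 2 means that there are 2-cells $\bar\rho_{X,Y}:XY\to XYB$ in $\mathcal K$ (the underlying 2-cells of $\hat\rho$), for $\overline X,\overline Y\in\mathcal C$, such that, with $\psi_{B,XY}=(X\times\psi_{B,Y})(\psi_{B,X}\times Y)$: (i) $(\zeta\times\xi\times B)\bar\rho_{X,Y}=\bar\rho_{X',Y'}(\zeta\times\xi)$ for morphisms $\zeta:\overline X\to\overline{X'}$, $\xi:\overline Y\to\overline{Y'}$ of $\mathcal C$; (ii) there is $\bar\rho^{-1}_{X,Y}:XY\to XYB$ with $(XY\times\mu_B)(\bar\rho^{-1}_{X,Y}\times B)\bar\rho_{X,Y}=XY\times\eta_B=(XY\times\mu_B)(\bar\rho_{X,Y}\times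 B)\bar\rho^{-1}_{X,Y}$; (iii) $(XY\times\mu_B)(\bar\rho_{X,Y}\times B)\psi_{B,XY}=(XY\times\mu_B)(\psi_{B,XY}\times B)(B\times\bar\rho_{X,Y})$; (iv) (2-cocycle, case of $r$, writing $\bar r$ for $\bar\rho$) $(XYZ\times\mu_B)(X\times\bar r_{Y,Z}\times B)\bar r_{X,YZ}\,\alpha=(XYZ\times\mu_B)(XY\times\psi_{B,Z}\times B)(\bar r_{X,Y}\times Z\times B)\bar r_{XY,Z}$; respectively (inverse form, case of $\rho$) $(\alpha\times\mu_B)(\bar\rho_{XY,Z}\times B)(XY\times\psi_{B,Z})(\bar\rho_{X,Y}\times Z)=(XYZ\times\mu_B)(\bar\rho_{X,YZ}\times B)(X\times\bar\rho_{Y,Z})$; (v) $\bar\rho_{X,\mathrm{Id}}=X\times\eta_B=\bar\rho_{\mathrm{Id},X}$. Coherence of the action with associativity $r$ (resp. $\rho$) means the pentagon $(X\times r_{Y,Z,M})r_{X,YZ,M}(\alpha\times M)=r_{X,Y,ZM}\,r_{XY,Z,M}$ (resp. $(\alpha\times M)\rho_{XY,Z,M}\rho_{X,Y,ZM}=\rho_{X,YZ,M}(X\times\rho_{Y,Z,M})$) and the unit triangles. *)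

theory Defs
  imports Main
begin

section \<open>Categories, functors, monoidal categories, actions\<close>

record ('o, 'a) cat =
  Obj :: "'o set"
  Arr :: "'a set"
  Dom :: "'a \<Rightarrow> 'o"
  Cod :: "'a \<Rightarrow> 'o"
  Ident :: "'o \<Rightarrow> 'a"
  Comp :: "'a \<Rightarrow> 'a \<Rightarrow> 'a"  (infixr "\<circ>\<index>" 55)

definition Hom :: "('o, 'a, 'z) cat_scheme \<Rightarrow> 'o \<Rightarrow> 'o \<Rightarrow> 'a set" where
  "Hom C X Y = {f \<in> Arr C. Dom C f = X \<and> Cod C f = Y}"

locale category =
  fixes C :: "('o, 'a, 'z) cat_scheme" (structure)
  assumes dom_closed: "f \<in> Arr C \<Longrightarrow> Dom C f \<in> Obj C"
    and cod_closed: "f \<in> Arr C \<Longrightarrow> Cod C f \<in> Obj C"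
    and ident_hom: "X \<in> Obj C \<Longrightarrow> Ident C X \<in> Hom C X X"
    and comp_hom: "f \<in> Hom C X Y \<Longrightarrow> g \<in> Hom C Y Z \<Longrightarrow> g \<circ> f \<in> Hom C X Z"
    and comp_ident_right: "f \<in> Hom C X Y \<Longrightarrow> f \<circ> Ident C X = f"
    and comp_ident_left: "f \<in> Hom C X Y \<Longrightarrow> Ident C Y \<circ> f = f"
    and comp_assoc: "f \<in> Hom C W X \<Longrightarrow> g \<in> Hom C X Y \<Longrightarrow> h \<in> Hom C Y Z
      \<Longrightarrow> (h \<circ> g) \<circ> f = h \<circ> (g \<circ> f)"

definition isos :: "('o, 'a, 'z) cat_scheme \<Rightarrow> 'o \<Rightarrow> 'o \<Rightarrow> 'a set" where
  "isos C X Y = {f \<in> Hom C X Y. \<exists>g \<in> Hom C Y X.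
     g \<circ>\<^bsub>C\<^esub> f = Ident C X \<and> f \<circ>\<^bsub>C\<^esub> g = Ident C Y}"

definition prod_cat :: "('o, 'a, 'y) cat_scheme \<Rightarrow> ('p, 'b, 'z) cat_scheme \<Rightarrow> ('o \<times> 'p, 'a \<times> 'b) cat" where
  "prod_cat C D = \<lparr>
     Obj = Obj C \<times> Obj D,
     Arr = Arr C \<times> Arr D,
     Dom = map_prod (Dom C) (Dom D),
     Cod = map_prod (Cod C) (Cod D),
     Ident = map_prod (Ident C) (Ident D),
     Comp = (\<lambda>(g, g') (f, f'). (g \<circ>\<^bsub>C\<^esub> f, g' \<circ>\<^bsub>D\<^esub> f')) \<rparr>"

record ('o, 'a, 'p, 'b) fctr =
  obj_map :: "'o \<Rightarrow> 'p"
  arr_map :: "'a \<Rightarrow> 'b"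

locale is_functor = C: category C + D: category D
  for C :: "('o, 'a, 'y) cat_scheme"
    and D :: "('p, 'b, 'z) cat_scheme"
    and F :: "('o, 'a, 'p, 'b) fctr" +
  assumes map_obj: "X \<in> Obj C \<Longrightarrow> obj_map F X \<in> Obj D"
    and map_hom: "f \<in> Hom C X Y \<Longrightarrow> arr_map F f \<in> Hom D (obj_map F X) (obj_map F Y)"
    and map_ident: "X \<in> Obj C \<Longrightarrow> arr_map F (Ident C X) = Ident D (obj_map F X)"
    and map_comp: "f \<in> Hom C X Y \<Longrightarrow> g \<in> Hom C Y Z
      \<Longrightarrow> arr_map F (g \<circ>\<^bsub>C\<^esub> f) = arr_map F g \<circ>\<^bsub>D\<^esub> arr_map F f"

definition faithful :: "('o, 'a, 'z) cat_scheme \<Rightarrow> ('o, 'a, 'p, 'b) fctr \<Rightarrow> bool" where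
  "faithful C F \<longleftrightarrow> (\<forall>X \<in> Obj C. \<forall>Y \<in> Obj C. inj_on (arr_map F) (Hom C X Y))"

record ('o, 'a) moncat = "('o, 'a) cat" +
  tens :: "'o \<Rightarrow> 'o \<Rightarrow> 'o"  (infixr "\<otimes>\<index>" 70)
  tens_arr :: "'a \<Rightarrow> 'a \<Rightarrow> 'a"  (infixr "\<boxtimes>\<index>" 70)
  unit_obj :: "'o"  ("\<one>\<index>")
  assoc :: "'o \<Rightarrow> 'o \<Rightarrow> 'o \<Rightarrow> 'a"
  lunit :: "'o \<Rightarrow> 'a"
  runit :: "'o \<Rightarrow> 'a"

definition tensor_functor :: "('o, 'a, 'z) moncat_scheme \<Rightarrow> ('o \<times> 'o, 'a \<times> 'a, 'o, 'a) fctr" where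
  "tensor_functor C = \<lparr> obj_map = (\<lambda>(X, Y). X \<otimes>\<^bsub>C\<^esub> Y), arr_map = (\<lambda>(f, g). f \<boxtimes>\<^bsub>C\<^esub> g) \<rparr>"

locale monoidal_category = category C
  for C :: "('o, 'a, 'z) moncat_scheme" (structure) +
  assumes tensor_is_functor: "is_functor (prod_cat C C) C (tensor_functor C)"
    and unit_closed: "\<one> \<in> Obj C"
    and assoc_iso: "X \<in> Obj C \<Longrightarrow> Y \<in> Obj C \<Longrightarrow> Z \<in> Obj C
      \<Longrightarrow> assoc C X Y Z \<in> isos C ((X \<otimes> Y) \<otimes> Z) (X \<otimes> (Y \<otimes> Z))"
    and assoc_natural: "f \<in> Hom C X X' \<Longrightarrow> g \<in> Hom C Y Y' \<Longrightarrow> h \<in> Hom C Z Z'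
      \<Longrightarrow> assoc C X' Y' Z' \<circ> ((f \<boxtimes> g) \<boxtimes> h) = (f \<boxtimes> (g \<boxtimes> h)) \<circ> assoc C X Y Z"
    and lunit_iso: "X \<in> Obj C \<Longrightarrow> lunit C X \<in> isos C (\<one> \<otimes> X) X"
    and lunit_natural: "f \<in> Hom C X X' \<Longrightarrow> lunit C X' \<circ> (Ident C \<one> \<boxtimes> f) = f \<circ> lunit C X"
    and runit_iso: "X \<in> Obj C \<Longrightarrow> runit C X \<in> isos C (X \<otimes> \<one>) X"
    and runit_natural: "f \<in> Hom C X X' \<Longrightarrow> runit C X' \<circ> (f \<boxtimes> Ident C \<one>) = f \<circ> runit C X"
    and pentagon: "W \<in> Obj C \<Longrightarrow> X \<in> Obj C \<Longrightarrow> Y \<in> Obj C \<Longrightarrow> Z \<in> Obj C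
      \<Longrightarrow> (Ident C W \<boxtimes> assoc C X Y Z) \<circ> assoc C W (X \<otimes> Y) Z \<circ> (assoc C W X Y \<boxtimes> Ident C Z)
        = assoc C W X (Y \<otimes> Z) \<circ> assoc C (W \<otimes> X) Y Z"
    and triangle: "X \<in> Obj C \<Longrightarrow> Y \<in> Obj C
      \<Longrightarrow> (Ident C X \<boxtimes> lunit C Y) \<circ> assoc C X \<one> Y = runit C X \<boxtimes> Ident C Y"

definition identity_unit_constraints :: "('o, 'a, 'z) moncat_scheme \<Rightarrow> bool" where
  "identity_unit_constraints C \<longleftrightarrow> (\<forall>X \<in> Obj C.
     \<one>\<^bsub>C\<^esub> \<otimes>\<^bsub>C\<^esub> X = X \<and> X \<otimes>\<^bsub>C\<^esub> \<one>\<^bsub>C\<^esub> = X \<and> lunit C X = Ident C X \<and> runit C X = Ident C X)"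

text \<open>A quasi-monoidal functor strictly preserves tensor products and the unit, but nothing
  is required about its values on the constraints.\<close>

locale quasi_monoidal_functor = is_functor C D F + C: monoidal_category C + D: monoidal_category D
  for C :: "('o, 'a, 'y) moncat_scheme"
    and D :: "('p, 'b, 'z) moncat_scheme"
    and F :: "('o, 'a, 'p, 'b) fctr" +
  assumes map_tens: "X \<in> Obj C \<Longrightarrow> Y \<in> Obj C
      \<Longrightarrow> obj_map F (X \<otimes>\<^bsub>C\<^esub> Y) = obj_map F X \<otimes>\<^bsub>D\<^esub> obj_map F Y"
    and map_tens_arr: "f \<in> Arr C \<Longrightarrow> g \<in> Arr C
      \<Longrightarrow> arr_map F (f \<boxtimes>\<^bsub>C\<^esub> g) = arr_map F f \<boxtimes>\<^bsub>D\<^esub> arr_map F g"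
    and map_unit: "obj_map F \<one>\<^bsub>C\<^esub> = \<one>\<^bsub>D\<^esub>"

text \<open>
  An action of a monoidal category \<open>C\<close> on a category \<open>D\<close> consists of a functor \<open>C \<times> D \<rightarrow> D\<close>,
  a unity-action isomorphism \<open>l\<close> and an associativity isomorphism, in one of two orientations:
  \<open>r X Y M : (X \<otimes> Y) M \<rightarrow> X (Y M)\<close>, or \<open>\<rho> X Y M : X (Y M) \<rightarrow> (X \<otimes> Y) M\<close>.
\<close>

locale unital_action_data =
  C: monoidal_category C + D: category D + is_functor "prod_cat C D" D act
  for C :: "('c, 'm, 'y) moncat_scheme"
    and D :: "('p, 'b, 'z) cat_scheme"
    and act :: "('c \<times> 'p, 'm \<times> 'b, 'p, 'b) fctr"
    and l :: "'p \<Rightarrow> 'b" +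
  assumes l_iso: "M \<in> Obj D \<Longrightarrow> l M \<in> isos D (obj_map act (\<one>\<^bsub>C\<^esub>, M)) M"
    and l_natural: "k \<in> Hom D M M'
      \<Longrightarrow> l M' \<circ>\<^bsub>D\<^esub> arr_map act (Ident C \<one>\<^bsub>C\<^esub>, k) = k \<circ>\<^bsub>D\<^esub> l M"

locale monoidal_action = unital_action_data C D act l
  for C :: "('c, 'm, 'y) moncat_scheme"
    and D :: "('p, 'b, 'z) cat_scheme"
    and act :: "('c \<times> 'p, 'm \<times> 'b, 'p, 'b) fctr"
    and l :: "'p \<Rightarrow> 'b"
    and r :: "'c \<Rightarrow> 'c \<Rightarrow> 'p \<Rightarrow> 'b" +
  assumes r_iso: "X \<in> Obj C \<Longrightarrow> Y \<in> Obj C \<Longrightarrow> M \<in> Obj D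
      \<Longrightarrow> r X Y M \<in> isos D (obj_map act (X \<otimes>\<^bsub>C\<^esub> Y, M)) (obj_map act (X, obj_map act (Y, M)))"
    and r_natural: "f \<in> Hom C X X' \<Longrightarrow> g \<in> Hom C Y Y' \<Longrightarrow> k \<in> Hom D M M'
      \<Longrightarrow> r X' Y' M' \<circ>\<^bsub>D\<^esub> arr_map act (f \<boxtimes>\<^bsub>C\<^esub> g, k)
        = arr_map act (f, arr_map act (g, k)) \<circ>\<^bsub>D\<^esub> r X Y M"
    and r_pentagon: "X \<in> Obj C \<Longrightarrow> Y \<in> Obj C \<Longrightarrow> Z \<in> Obj C \<Longrightarrow> M \<in> Obj D
      \<Longrightarrow> arr_map act (Ident C X, r Y Z M) \<circ>\<^bsub>D\<^esub> r X (Y \<otimes>\<^bsub>C\<^esub> Z) M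
            \<circ>\<^bsub>D\<^esub> arr_map act (assoc C X Y Z, Ident D M)
        = r X Y (obj_map act (Z, M)) \<circ>\<^bsub>D\<^esub> r (X \<otimes>\<^bsub>C\<^esub> Y) Z M"
    and r_triangle_right: "X \<in> Obj C \<Longrightarrow> M \<in> Obj D
      \<Longrightarrow> arr_map act (Ident C X, l M) \<circ>\<^bsub>D\<^esub> r X \<one>\<^bsub>C\<^esub> M = arr_map act (runit C X, Ident D M)"
    and r_triangle_left: "X \<in> Obj C \<Longrightarrow> M \<in> Obj D
      \<Longrightarrow> l (obj_map act (X, M)) \<circ>\<^bsub>D\<^esub> r \<one>\<^bsub>C\<^esub> X M = arr_map act (lunit C X, Ident D M)"

locale monoidal_action_inverse_form = unital_action_data C D act l
  for C :: "('c, 'm, 'y) moncat_scheme"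
    and D :: "('p, 'b, 'z) cat_scheme"
    and act :: "('c \<times> 'p, 'm \<times> 'b, 'p, 'b) fctr"
    and l :: "'p \<Rightarrow> 'b"
    and \<rho> :: "'c \<Rightarrow> 'c \<Rightarrow> 'p \<Rightarrow> 'b" +
  assumes \<rho>_iso: "X \<in> Obj C \<Longrightarrow> Y \<in> Obj C \<Longrightarrow> M \<in> Obj D
      \<Longrightarrow> \<rho> X Y M \<in> isos D (obj_map act (X, obj_map act (Y, M))) (obj_map act (X \<otimes>\<^bsub>C\<^esub> Y, M))"
    and \<rho>_natural: "f \<in> Hom C X X' \<Longrightarrow> g \<in> Hom C Y Y' \<Longrightarrow> k \<in> Hom D M M'
      \<Longrightarrow> \<rho> X' Y' M' \<circ>\<^bsub>D\<^esub> arr_map act (f, arr_map act (g, k))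
        = arr_map act (f \<boxtimes>\<^bsub>C\<^esub> g, k) \<circ>\<^bsub>D\<^esub> \<rho> X Y M"
    and \<rho>_pentagon: "X \<in> Obj C \<Longrightarrow> Y \<in> Obj C \<Longrightarrow> Z \<in> Obj C \<Longrightarrow> M \<in> Obj D
      \<Longrightarrow> arr_map act (assoc C X Y Z, Ident D M) \<circ>\<^bsub>D\<^esub> \<rho> (X \<otimes>\<^bsub>C\<^esub> Y) Z M
            \<circ>\<^bsub>D\<^esub> \<rho> X Y (obj_map act (Z, M))
        = \<rho> X (Y \<otimes>\<^bsub>C\<^esub> Z) M \<circ>\<^bsub>D\<^esub> arr_map act (Ident C X, \<rho> Y Z M)"
    and \<rho>_triangle_right: "X \<in> Obj C \<Longrightarrow> M \<in> Obj D
      \<Longrightarrow> arr_map act (runit C X, Ident D M) \<circ>\<^bsub>D\<^esub> \<rho> X \<one>\<^bsub>C\<^esub> M = arr_map act (Ident C X, l M)"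
    and \<rho>_triangle_left: "X \<in> Obj C \<Longrightarrow> M \<in> Obj D
      \<Longrightarrow> arr_map act (lunit C X, Ident D M) \<circ>\<^bsub>D\<^esub> \<rho> \<one>\<^bsub>C\<^esub> X M = l (obj_map act (X, M))"


section \<open>Strict 2-categories and monads\<close>

record ('o, 'f, 't) two_cat =
  cells0 :: "'o set"
  cells1 :: "'f set"
  cells2 :: "'t set"
  src :: "'f \<Rightarrow> 'o"
  trg :: "'f \<Rightarrow> 'o"
  dom2 :: "'t \<Rightarrow> 'f"
  cod2 :: "'t \<Rightarrow> 'f"
  id1 :: "'o \<Rightarrow> 'f"
  comp1 :: "'f \<Rightarrow> 'f \<Rightarrow> 'f"  (infixr "\<cdot>\<index>" 75)
  id2 :: "'f \<Rightarrow> 't"  ("\<iota>\<index>")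
  hcomp :: "'t \<Rightarrow> 't \<Rightarrow> 't"  (infixr "\<star>\<index>" 70)
  vcomp :: "'t \<Rightarrow> 't \<Rightarrow> 't"  (infixr "\<bullet>\<index>" 60)

definition hom1 :: "('o, 'f, 't, 'z) two_cat_scheme \<Rightarrow> 'o \<Rightarrow> 'o \<Rightarrow> 'f set" where
  "hom1 K P Q = {X \<in> cells1 K. src K X = P \<and> trg K X = Q}"

definition hom2 :: "('o, 'f, 't, 'z) two_cat_scheme \<Rightarrow> 'f \<Rightarrow> 'f \<Rightarrow> 't set" where
  "hom2 K X Y = {\<zeta> \<in> cells2 K. dom2 K \<zeta> = X \<and> cod2 K \<zeta> = Y}"

text \<open>Composites are written in the order of application of functions: \<open>X \<cdot> Y\<close> is
  ``first \<open>Y\<close>, then \<open>X\<close>'', and likewise for \<open>\<star>\<close> (horizontal) and \<open>\<bullet>\<close> (vertical).\<close>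

locale two_category =
  fixes K :: "('o, 'f, 't, 'z) two_cat_scheme" (structure)
  assumes src_closed: "X \<in> cells1 K \<Longrightarrow> src K X \<in> cells0 K"
    and trg_closed: "X \<in> cells1 K \<Longrightarrow> trg K X \<in> cells0 K"
    and id1_hom: "P \<in> cells0 K \<Longrightarrow> id1 K P \<in> hom1 K P P"
    and comp1_hom: "Y \<in> hom1 K P Q \<Longrightarrow> X \<in> hom1 K Q R \<Longrightarrow> X \<cdot> Y \<in> hom1 K P R"
    and comp1_id_right: "X \<in> hom1 K P Q \<Longrightarrow> X \<cdot> id1 K P = X"
    and comp1_id_left: "X \<in> hom1 K P Q \<Longrightarrow> id1 K Q \<cdot> X = X"
    and comp1_assoc: "Z \<in> hom1 K P Q \<Longrightarrow> Y \<in> hom1 K Q R \<Longrightarrow> X \<in> hom1 K R S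
      \<Longrightarrow> (X \<cdot> Y) \<cdot> Z = X \<cdot> (Y \<cdot> Z)"
    and dom2_closed: "\<zeta> \<in> cells2 K \<Longrightarrow> dom2 K \<zeta> \<in> cells1 K"
    and cod2_closed: "\<zeta> \<in> cells2 K \<Longrightarrow> cod2 K \<zeta> \<in> cells1 K"
    and src_parallel: "\<zeta> \<in> cells2 K \<Longrightarrow> src K (dom2 K \<zeta>) = src K (cod2 K \<zeta>)"
    and trg_parallel: "\<zeta> \<in> cells2 K \<Longrightarrow> trg K (dom2 K \<zeta>) = trg K (cod2 K \<zeta>)"
    and id2_hom: "X \<in> cells1 K \<Longrightarrow> \<iota> X \<in> hom2 K X X"
    and vcomp_hom: "\<zeta> \<in> hom2 K X Y \<Longrightarrow> \<xi> \<in> hom2 K Y Z \<Longrightarrow> \<xi> \<bullet> \<zeta> \<in> hom2 K X Z"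
    and vcomp_id_right: "\<zeta> \<in> hom2 K X Y \<Longrightarrow> \<zeta> \<bullet> \<iota> X = \<zeta>"
    and vcomp_id_left: "\<zeta> \<in> hom2 K X Y \<Longrightarrow> \<iota> Y \<bullet> \<zeta> = \<zeta>"
    and vcomp_assoc: "\<zeta> \<in> hom2 K W X \<Longrightarrow> \<xi> \<in> hom2 K X Y \<Longrightarrow> \<chi> \<in> hom2 K Y Z
      \<Longrightarrow> (\<chi> \<bullet> \<xi>) \<bullet> \<zeta> = \<chi> \<bullet> (\<xi> \<bullet> \<zeta>)"
    and hcomp_hom: "Y \<in> hom1 K P Q \<Longrightarrow> X \<in> hom1 K Q R
      \<Longrightarrow> \<xi> \<in> hom2 K Y Y' \<Longrightarrow> \<zeta> \<in> hom2 K X X' \<Longrightarrow> \<zeta> \<star> \<xi> \<in> hom2 K (X \<cdot> Y) (X' \<cdot> Y')"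
    and hcomp_id_right: "X \<in> hom1 K P Q \<Longrightarrow> \<zeta> \<in> hom2 K X X' \<Longrightarrow> \<zeta> \<star> \<iota> (id1 K P) = \<zeta>"
    and hcomp_id_left: "X \<in> hom1 K P Q \<Longrightarrow> \<zeta> \<in> hom2 K X X' \<Longrightarrow> \<iota> (id1 K Q) \<star> \<zeta> = \<zeta>"
    and hcomp_assoc: "Z \<in> hom1 K P Q \<Longrightarrow> Y \<in> hom1 K Q R \<Longrightarrow> X \<in> hom1 K R S
      \<Longrightarrow> \<chi> \<in> hom2 K Z Z' \<Longrightarrow> \<xi> \<in> hom2 K Y Y' \<Longrightarrow> \<zeta> \<in> hom2 K X X'
      \<Longrightarrow> (\<zeta> \<star> \<xi>) \<star> \<chi> = \<zeta> \<star> (\<xi> \<star> \<chi>)"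
    and hcomp_id2: "Y \<in> hom1 K P Q \<Longrightarrow> X \<in> hom1 K Q R \<Longrightarrow> \<iota> X \<star> \<iota> Y = \<iota> (X \<cdot> Y)"
    and interchange: "Y \<in> hom1 K P Q \<Longrightarrow> X \<in> hom1 K Q R
      \<Longrightarrow> \<xi> \<in> hom2 K Y Y' \<Longrightarrow> \<xi>' \<in> hom2 K Y' Y'' \<Longrightarrow> \<zeta> \<in> hom2 K X X' \<Longrightarrow> \<zeta>' \<in> hom2 K X' X''
      \<Longrightarrow> (\<zeta>' \<bullet> \<zeta>) \<star> (\<xi>' \<bullet> \<xi>) = (\<zeta>' \<star> \<xi>') \<bullet> (\<zeta> \<star> \<xi>)"

locale monad_in = two_category K
  for K :: "('o, 'f, 't, 'z) two_cat_scheme" (structure) and A B \<mu> \<eta> +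
  assumes base_closed: "A \<in> cells0 K"
    and endo: "B \<in> hom1 K A A"
    and mult_hom: "\<mu> \<in> hom2 K (B \<cdot> B) B"
    and unit_hom: "\<eta> \<in> hom2 K (id1 K A) B"
    and mult_assoc: "\<mu> \<bullet> (\<mu> \<star> \<iota> B) = \<mu> \<bullet> (\<iota> B \<star> \<mu>)"
    and mult_unit_left: "\<mu> \<bullet> (\<eta> \<star> \<iota> B) = \<iota> B"
    and mult_unit_right: "\<mu> \<bullet> (\<iota> B \<star> \<eta>) = \<iota> B"


section \<open>Modules, the category \<open>T(A,B)\<close>, and the Eilenberg--Moore 2-category\<close>

text \<open>The arrows of the categories below are 2-cells of the ambient 2-category, tagged with
  their source and target objects (which a bare 2-cell does not determine).\<close>

datatype ('p, 't) arrow = Arrow (source: 'p) (cell: 't) (target: 'p)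

text \<open>The source 0-cell of a module is arbitrary; a 2-cell \<open>M \<Rightarrow> N\<close> exists only between modules with
  the same source.\<close>

definition modules_cat :: "('o, 'f, 't, 'z) two_cat_scheme \<Rightarrow> 'o \<Rightarrow> 'f \<Rightarrow> 't \<Rightarrow> 't
    \<Rightarrow> ('f \<times> 't, ('f \<times> 't, 't) arrow) cat"
  where "modules_cat K A B \<mu> \<eta> = (let
    modules = {(M, \<nu>). M \<in> cells1 K \<and> trg K M = A \<and> \<nu> \<in> hom2 K (B \<cdot> M) M \<and>
      \<nu> \<bullet> (\<mu> \<star> \<iota> M) = \<nu> \<bullet> (\<iota> B \<star> \<nu>) \<and>
      \<nu> \<bullet> (\<eta> \<star> \<iota> M) = \<iota> M}
    in \<lparr>
      Obj = modules,
      Arr = {Arrow (M, \<nu>) f (N, \<nu>') | M \<nu> f N \<nu>'. (M, \<nu>) \<in> modules \<and> (N, \<nu>') \<in> modules \<and>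
        f \<in> hom2 K M N \<and> f \<bullet> \<nu> = \<nu>' \<bullet> (\<iota> B \<star> f)},
      Dom = source,
      Cod = target,
      Ident = (\<lambda>(M, \<nu>). Arrow (M, \<nu>) (\<iota> M) (M, \<nu>)),
      Comp = (\<lambda>g f. Arrow (source f) (cell g \<bullet> cell f) (target g)) \<rparr>)"
  for K (structure)

definition twisted_endos :: "('o, 'f, 't, 'z) two_cat_scheme \<Rightarrow> 'o \<Rightarrow> 'f \<Rightarrow> 't \<Rightarrow> 't \<Rightarrow> ('f \<times> 't) set"
  where "twisted_endos K A B \<mu> \<eta> = {(X, \<psi>). X \<in> hom1 K A A \<and> \<psi> \<in> hom2 K (B \<cdot> X) (X \<cdot> B) \<and>
     \<psi> \<bullet> (\<mu> \<star> \<iota> X) = (\<iota> X \<star> \<mu>) \<bullet> (\<psi> \<star> \<iota> B) \<bullet> (\<iota> B \<star> \<psi>) \<and>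
     \<psi> \<bullet> (\<eta> \<star> \<iota> X) = \<iota> X \<star> \<eta>}"
  for K (structure)

definition tens_twisted :: "('o, 'f, 't, 'z) two_cat_scheme \<Rightarrow> 'f \<times> 't \<Rightarrow> 'f \<times> 't \<Rightarrow> 'f \<times> 't"
  where "tens_twisted K = (\<lambda>(X, \<psi>) (Y, \<psi>'). (X \<cdot> Y, (\<iota> X \<star> \<psi>') \<bullet> (\<psi> \<star> \<iota> Y)))"
  for K (structure)

definition T_cat :: "('o, 'f, 't, 'z) two_cat_scheme \<Rightarrow> 'o \<Rightarrow> 'f \<Rightarrow> 't \<Rightarrow> 't
    \<Rightarrow> ('f \<times> 't, ('f \<times> 't, 't) arrow) moncat"
  where "T_cat K A B \<mu> \<eta> = (let
    ident = (\<lambda>(X, \<psi>). Arrow (X, \<psi>) (\<iota> X) (X, \<psi>))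
    in \<lparr>
      Obj = twisted_endos K A B \<mu> \<eta>,
      Arr = {Arrow (X, \<psi>) \<zeta> (Y, \<psi>') | X \<psi> \<zeta> Y \<psi>'.
        (X, \<psi>) \<in> twisted_endos K A B \<mu> \<eta> \<and> (Y, \<psi>') \<in> twisted_endos K A B \<mu> \<eta> \<and>
        \<zeta> \<in> hom2 K X Y \<and> (\<zeta> \<star> \<iota> B) \<bullet> \<psi> = \<psi>' \<bullet> (\<iota> B \<star> \<zeta>)},
      Dom = source,
      Cod = target,
      Ident = ident,
      Comp = (\<lambda>g f. Arrow (source f) (cell g \<bullet> cell f) (target g)),
      tens = tens_twisted K,
      tens_arr = (\<lambda>f g. Arrow (tens_twisted K (source f) (source g)) (cell f \<star> cell g)
        (tens_twisted K (target f) (target g))),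
      unit_obj = (id1 K A, \<iota> B),
      assoc = (\<lambda>P Q R. ident (tens_twisted K P (tens_twisted K Q R))),
      lunit = ident,
      runit = ident \<rparr>)"
  for K (structure)

text \<open>Only the hom-category of endo-1-cells of \<open>B\<close> of the Eilenberg--Moore 2-category for monads
  is needed; its composition is the vertical one.\<close>

definition EM_endo_cat :: "('o, 'f, 't, 'z) two_cat_scheme \<Rightarrow> 'o \<Rightarrow> 'f \<Rightarrow> 't \<Rightarrow> 't
    \<Rightarrow> ('f \<times> 't, ('f \<times> 't, 't) arrow) cat"
  where "EM_endo_cat K A B \<mu> \<eta> = \<lparr>
      Obj = twisted_endos K A B \<mu> \<eta>,
      Arr = {Arrow (X, \<psi>) \<zeta> (Y, \<psi>') | X \<psi> \<zeta> Y \<psi>'.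
        (X, \<psi>) \<in> twisted_endos K A B \<mu> \<eta> \<and> (Y, \<psi>') \<in> twisted_endos K A B \<mu> \<eta> \<and>
        \<zeta> \<in> hom2 K X (Y \<cdot> B) \<and>
        (\<iota> Y \<star> \<mu>) \<bullet> (\<zeta> \<star> \<iota> B) \<bullet> \<psi> = (\<iota> Y \<star> \<mu>) \<bullet> (\<psi>' \<star> \<iota> B) \<bullet> (\<iota> B \<star> \<zeta>)},
      Dom = source,
      Cod = target,
      Ident = (\<lambda>(X, \<psi>). Arrow (X, \<psi>) (\<iota> X \<star> \<eta>) (X, \<psi>)),
      Comp = (\<lambda>g f. Arrow (source f)
        ((\<iota> (fst (target g)) \<star> \<mu>) \<bullet> (cell g \<star> \<iota> B) \<bullet> cell f) (target g)) \<rparr>"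
  for K (structure)


section \<open>The two equivalent conditions\<close>

text \<open>A functor \<open>F\<close> into \<open>T(A,B)\<close> sends \<open>X\<close> to \<open>(carrier1 F X, twist F X)\<close>, and an arrow \<open>f\<close>
  to an arrow with underlying 2-cell \<open>carrier2 F f\<close>.\<close>

definition carrier1 :: "('c, 'm, 'f \<times> 't, ('f \<times> 't, 't) arrow) fctr \<Rightarrow> 'c \<Rightarrow> 'f" where
  "carrier1 F X = fst (obj_map F X)"

definition twist :: "('c, 'm, 'f \<times> 't, ('f \<times> 't, 't) arrow) fctr \<Rightarrow> 'c \<Rightarrow> 't" where
  "twist F X = snd (obj_map F X)"

definition carrier2 :: "('c, 'm, 'f \<times> 't, ('f \<times> 't, 't) arrow) fctr \<Rightarrow> 'm \<Rightarrow> 't" where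
  "carrier2 F f = cell (arr_map F f)"

definition factors_through :: "('c, 'm, 'y) cat_scheme
    \<Rightarrow> ('c, 'm, 'f \<times> 't, ('f \<times> 't, 't) arrow) fctr
    \<Rightarrow> ('c, 'm, 'f \<times> 't, ('f \<times> 't, 't) arrow) fctr \<Rightarrow> bool" where
  "factors_through C F U \<longleftrightarrow>
     (\<forall>X \<in> Obj C. carrier1 F X = carrier1 U X) \<and> (\<forall>f \<in> Arr C. carrier2 F f = carrier2 U f)"

definition module_act :: "('o, 'f, 't, 'z) two_cat_scheme \<Rightarrow> ('c, 'm, 'y) moncat_scheme
    \<Rightarrow> ('c, 'm, 'f \<times> 't, ('f \<times> 't, 't) arrow) fctr
    \<Rightarrow> ('c \<times> ('f \<times> 't), 'm \<times> ('f \<times> 't, 't) arrow, 'f \<times> 't, ('f \<times> 't, 't) arrow) fctr"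
  where "module_act K C F = (let
    act = (\<lambda>X (M, \<nu>). (carrier1 F X \<cdot> M, (\<iota> (carrier1 F X) \<star> \<nu>) \<bullet> (twist F X \<star> \<iota> M)))
    in \<lparr>
      obj_map = (\<lambda>(X, M). act X M),
      arr_map = (\<lambda>(f, k).
        Arrow (act (Dom C f) (source k)) (carrier2 F f \<star> cell k) (act (Cod C f) (target k))) \<rparr>)"
  for K (structure)

text \<open>This applies to both orientations of the associativity isomorphism, since source and target
  have the same underlying 1-cell; \<open>(B, \<mu>)\<close> is the regular module.\<close>

definition determined_by_regular :: "('o, 'f, 't, 'z) two_cat_scheme \<Rightarrow> 'o \<Rightarrow> 'f \<Rightarrow> 't \<Rightarrow> 't
    \<Rightarrow> ('c, 'm, 'y) moncat_scheme \<Rightarrow> ('c, 'm, 'f \<times> 't, ('f \<times> 't, 't) arrow) fctr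
    \<Rightarrow> ('c \<Rightarrow> 'c \<Rightarrow> 'f \<times> 't \<Rightarrow> ('f \<times> 't, 't) arrow) \<Rightarrow> bool"
  where "determined_by_regular K A B \<mu> \<eta> C F r \<longleftrightarrow>
    (\<forall>X \<in> Obj C. \<forall>Y \<in> Obj C. \<forall>(M, \<nu>) \<in> Obj (modules_cat K A B \<mu> \<eta>).
      let XY = carrier1 F X \<cdot> carrier1 F Y
      in cell (r X Y (M, \<nu>)) =
        (\<iota> XY \<star> \<nu>) \<bullet> (cell (r X Y (B, \<mu>)) \<star> \<iota> M) \<bullet> (\<iota> XY \<star> \<eta> \<star> \<iota> M))"
  for K (structure)

text \<open>Invertibility is in the Eilenberg--Moore 2-category; naturality in \<open>X\<close>, \<open>Y\<close> and normalization
  are written out on underlying 2-cells (the identity 2-cell of \<open>X\<close> there is \<open>X \<star> \<eta>\<close>).\<close>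

definition normalized_EM_operator :: "('o, 'f, 't, 'z) two_cat_scheme \<Rightarrow> 'o \<Rightarrow> 'f \<Rightarrow> 't \<Rightarrow> 't
    \<Rightarrow> ('c, 'm, 'y) moncat_scheme \<Rightarrow> ('c, 'm, 'f \<times> 't, ('f \<times> 't, 't) arrow) fctr
    \<Rightarrow> ('c \<Rightarrow> 'c \<Rightarrow> ('f \<times> 't, 't) arrow) \<Rightarrow> bool"
  where "normalized_EM_operator K A B \<mu> \<eta> C F \<rho> \<longleftrightarrow>
    (\<forall>X \<in> Obj C. \<forall>Y \<in> Obj C.
      \<rho> X Y \<in> isos (EM_endo_cat K A B \<mu> \<eta>)
        (tens_twisted K (obj_map F X) (obj_map F Y)) (tens_twisted K (obj_map F X) (obj_map F Y))) \<and>
    (\<forall>\<zeta> \<in> Arr C. \<forall>\<xi> \<in> Arr C.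
      (carrier2 F \<zeta> \<star> carrier2 F \<xi> \<star> \<iota> B) \<bullet> cell (\<rho> (Dom C \<zeta>) (Dom C \<xi>)) =
      cell (\<rho> (Cod C \<zeta>) (Cod C \<xi>)) \<bullet> (carrier2 F \<zeta> \<star> carrier2 F \<xi>)) \<and>
    (\<forall>X \<in> Obj C.
      cell (\<rho> X \<one>\<^bsub>C\<^esub>) = \<iota> (carrier1 F X) \<star> \<eta> \<and>
      cell (\<rho> \<one>\<^bsub>C\<^esub> X) = \<iota> (carrier1 F X) \<star> \<eta>)"
  for K (structure)

text \<open>
  The cocycle conditions, written out on underlying 2-cells.  In the Eilenberg--Moore 2-category,
  the left whiskering of \<open>\<zeta> : Y \<rightarrow> Y' B\<close> by \<open>X\<close> is \<open>X \<star> \<zeta>\<close>, the right whiskering of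
  \<open>\<zeta> : X \<rightarrow> X' B\<close> by \<open>(Z, \<psi>)\<close> is \<open>(X' \<star> \<psi>) \<bullet> (\<zeta> \<star> Z)\<close>, and the 2-cell \<open>\<zeta> : X \<rightarrow> Y\<close> underlying
  an arrow of \<open>T(A,B)\<close> is regarded as \<open>(Y \<star> \<eta>) \<bullet> \<zeta>\<close>.  The image \<open>\<alpha>\<close> of the associativity
  constraint of \<open>C\<close> enters because it need not be an identity.
\<close>

definition EM_cocycle :: "('o, 'f, 't, 'z) two_cat_scheme \<Rightarrow> 'f \<Rightarrow> 't
    \<Rightarrow> ('c, 'm, 'y) moncat_scheme \<Rightarrow> ('c, 'm, 'f \<times> 't, ('f \<times> 't, 't) arrow) fctr
    \<Rightarrow> ('c \<Rightarrow> 'c \<Rightarrow> ('f \<times> 't, 't) arrow) \<Rightarrow> bool"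
  where "EM_cocycle K B \<mu> C F \<rho> \<longleftrightarrow>
    (\<forall>X \<in> Obj C. \<forall>Y \<in> Obj C. \<forall>Z \<in> Obj C.
      let X\<^sub>1 = carrier1 F X; Y\<^sub>1 = carrier1 F Y; Z\<^sub>1 = carrier1 F Z; XYZ = X\<^sub>1 \<cdot> Y\<^sub>1 \<cdot> Z\<^sub>1;
          \<alpha> = carrier2 F (assoc C X Y Z)
      in (\<iota> XYZ \<star> \<mu>) \<bullet> (\<iota> X\<^sub>1 \<star> cell (\<rho> Y Z) \<star> \<iota> B) \<bullet> cell (\<rho> X (Y \<otimes>\<^bsub>C\<^esub> Z)) \<bullet> \<alpha> =
         (\<iota> XYZ \<star> \<mu>) \<bullet> (\<iota> (X\<^sub>1 \<cdot> Y\<^sub>1) \<star> twist F Z \<star> \<iota> B) \<bullet> (cell (\<rho> X Y) \<star> \<iota> Z\<^sub>1 \<star> \<iota> B)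
           \<bullet> cell (\<rho> (X \<otimes>\<^bsub>C\<^esub> Y) Z))"
  for K (structure)

definition EM_cocycle_inverse_form :: "('o, 'f, 't, 'z) two_cat_scheme \<Rightarrow> 'f \<Rightarrow> 't
    \<Rightarrow> ('c, 'm, 'y) moncat_scheme \<Rightarrow> ('c, 'm, 'f \<times> 't, ('f \<times> 't, 't) arrow) fctr
    \<Rightarrow> ('c \<Rightarrow> 'c \<Rightarrow> ('f \<times> 't, 't) arrow) \<Rightarrow> bool"
  where "EM_cocycle_inverse_form K B \<mu> C F \<rho> \<longleftrightarrow>
    (\<forall>X \<in> Obj C. \<forall>Y \<in> Obj C. \<forall>Z \<in> Obj C.
      let X\<^sub>1 = carrier1 F X; Y\<^sub>1 = carrier1 F Y; Z\<^sub>1 = carrier1 F Z; XYZ = X\<^sub>1 \<cdot> Y\<^sub>1 \<cdot> Z\<^sub>1;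
          \<alpha> = carrier2 F (assoc C X Y Z)
      in (\<alpha> \<star> \<mu>) \<bullet> (cell (\<rho> (X \<otimes>\<^bsub>C\<^esub> Y) Z) \<star> \<iota> B) \<bullet> (\<iota> (X\<^sub>1 \<cdot> Y\<^sub>1) \<star> twist F Z)
           \<bullet> (cell (\<rho> X Y) \<star> \<iota> Z\<^sub>1) =
         (\<iota> XYZ \<star> \<mu>) \<bullet> (cell (\<rho> X (Y \<otimes>\<^bsub>C\<^esub> Z)) \<star> \<iota> B) \<bullet> (\<iota> X\<^sub>1 \<star> cell (\<rho> Y Z)))"
  for K (structure)

end

theory Submission
  imports Defs
begin

text \<open>
  An Eilenberg--Moore 2-cell \<open>\<sigma> : X \<rightarrow> Y B\<close> induces on every module \<open>(M, \<nu>)\<close> the 2-cell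
  \<open>(Y \<star> \<nu>) \<bullet> (\<sigma> \<star> M) : X M \<rightarrow> Y M\<close>.  This assignment turns the Eilenberg--Moore composition into
  composition of module maps, respects whiskering, and is injective already on the regular module
  \<open>(B, \<mu>)\<close>, where precomposition with \<open>X \<star> \<eta>\<close> recovers \<open>\<sigma>\<close>.  The determination condition says
  that the associativity constraint is induced by \<open>\<rho> X Y = r X Y B \<bullet> (X Y \<star> \<eta>)\<close>, so each axiom
  for the action is the image of the corresponding axiom for \<open>\<rho>\<close>, and conversely the axioms for \<open>\<rho>\<close>
  are read off on the regular module.  Since both bracketings of \<open>X Y M\<close> are the same module, the two
  orientations of the associativity constraint differ only in the pentagon.
\<close>

section \<open>Products of categories\<close>

lemma Hom_prod_cat:
  "(f, g) \<in> Hom (prod_cat D E) (X, Y) (X', Y') \<longleftrightarrow>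
    f \<in> Hom D X X' \<and> g \<in> Hom E Y Y'"
  by (auto simp: Hom_def prod_cat_def)

lemma category_prod_cat:
  assumes "category C" "category D"
  shows "category (prod_cat C D)"
proof -
  interpret C: category C by fact
  interpret D: category D by fact
  show ?thesis
    by standard (auto simp: prod_cat_def Hom_def C.dom_closed C.cod_closed D.dom_closed D.cod_closed
      C.ident_hom[unfolded Hom_def, simplified] D.ident_hom[unfolded Hom_def, simplified]
      C.comp_hom[unfolded Hom_def, simplified] D.comp_hom[unfolded Hom_def, simplified]
      C.comp_ident_left[unfolded Hom_def, simplified] D.comp_ident_left[unfolded Hom_def, simplified]
      C.comp_ident_right[unfolded Hom_def, simplified] D.comp_ident_right[unfolded Hom_def, simplified]
      C.comp_assoc[unfolded Hom_def, simplified] D.comp_assoc[unfolded Hom_def, simplified])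
qed


section \<open>Calculating in a strict 2-category\<close>

context two_category
begin

lemma id1_cell [simp]:
  assumes "P \<in> cells0 K"
  shows "id1 K P \<in> cells1 K" "src K (id1 K P) = P" "trg K (id1 K P) = P"
  using id1_hom[OF assms] by (auto simp: hom1_def)

lemma comp1_cell [simp]:
  assumes "X \<in> cells1 K" "Y \<in> cells1 K" "src K X = trg K Y"
  shows "X \<cdot> Y \<in> cells1 K" "src K (X \<cdot> Y) = src K Y" "trg K (X \<cdot> Y) = trg K X"
  using comp1_hom[of Y "src K Y" "trg K Y" X "trg K X"] assms by (auto simp: hom1_def)

lemma comp1_assoc' [simp]:
  assumes "X \<in> cells1 K" "Y \<in> cells1 K" "Z \<in> cells1 K" "src K X = trg K Y" "src K Y = trg K Z"
  shows "(X \<cdot> Y) \<cdot> Z = X \<cdot> (Y \<cdot> Z)"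
  using assms comp1_assoc[of Z "src K Z" "trg K Z" Y "trg K Y" X "trg K X"]
  by (auto simp: hom1_def)

lemma comp1_id [simp]:
  assumes "X \<in> cells1 K"
  shows "src K X = P \<Longrightarrow> X \<cdot> id1 K P = X" "trg K X = P \<Longrightarrow> id1 K P \<cdot> X = X"
  using assms comp1_id_right[of X P "trg K X"] comp1_id_left[of X "src K X" P]
  by (auto simp: hom1_def)

lemma id2_cell [simp]:
  assumes "X \<in> cells1 K"
  shows "\<iota> X \<in> cells2 K" "dom2 K (\<iota> X) = X" "cod2 K (\<iota> X) = X"
  using id2_hom[OF assms] by (auto simp: hom2_def)

lemma vcomp_cell [simp]:
  assumes "f \<in> cells2 K" "g \<in> cells2 K" "dom2 K g = cod2 K f"
  shows "g \<bullet> f \<in> cells2 K" "dom2 K (g \<bullet> f) = dom2 K f" "cod2 K (g \<bullet> f) = cod2 K g"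
  using vcomp_hom[of f "dom2 K f" "cod2 K f" g "cod2 K g"] assms by (auto simp: hom2_def)

lemma vcomp_assoc' [simp]:
  assumes "f \<in> cells2 K" "g \<in> cells2 K" "h \<in> cells2 K" "dom2 K g = cod2 K f" "dom2 K h = cod2 K g"
  shows "(h \<bullet> g) \<bullet> f = h \<bullet> (g \<bullet> f)"
  using assms vcomp_assoc[of f "dom2 K f" "cod2 K f" g "cod2 K g" h "cod2 K h"]
  by (auto simp: hom2_def)

lemma vcomp_id [simp]:
  assumes "f \<in> cells2 K"
  shows "dom2 K f = X \<Longrightarrow> f \<bullet> \<iota> X = f" "cod2 K f = X \<Longrightarrow> \<iota> X \<bullet> f = f"
  using assms vcomp_id_right[of f X "cod2 K f"] vcomp_id_left[of f "dom2 K f" X]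
  by (auto simp: hom2_def)

lemma hcomp_cell [simp]:
  assumes "f \<in> cells2 K" "g \<in> cells2 K" "src K (dom2 K f) = trg K (dom2 K g)"
  shows "f \<star> g \<in> cells2 K" "dom2 K (f \<star> g) = dom2 K f \<cdot> dom2 K g"
    "cod2 K (f \<star> g) = cod2 K f \<cdot> cod2 K g"
  using assms dom2_closed
    hcomp_hom[of "dom2 K g" "src K (dom2 K g)" "trg K (dom2 K g)" "dom2 K f" "trg K (dom2 K f)"
      g "cod2 K g" f "cod2 K f"]
  by (auto simp: hom1_def hom2_def)

lemma hcomp_assoc' [simp]:
  assumes "f \<in> cells2 K" "g \<in> cells2 K" "h \<in> cells2 K"
    "src K (dom2 K f) = trg K (dom2 K g)" "src K (dom2 K g) = trg K (dom2 K h)"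
  shows "(f \<star> g) \<star> h = f \<star> (g \<star> h)"
  using assms dom2_closed
    hcomp_assoc[of "dom2 K h" "src K (dom2 K h)" "trg K (dom2 K h)" "dom2 K g" "trg K (dom2 K g)"
      "dom2 K f" "trg K (dom2 K f)" h "cod2 K h" g "cod2 K g" f "cod2 K f"]
  by (auto simp: hom1_def hom2_def)

lemma hcomp_id [simp]:
  assumes "f \<in> cells2 K"
  shows "src K (dom2 K f) = P \<Longrightarrow> f \<star> \<iota> (id1 K P) = f"
    "trg K (dom2 K f) = P \<Longrightarrow> \<iota> (id1 K P) \<star> f = f"
  using assms dom2_closed
    hcomp_id_right[of "dom2 K f" P "trg K (dom2 K f)" f "cod2 K f"]
    hcomp_id_left[of "dom2 K f" "src K (dom2 K f)" P f "cod2 K f"]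
  by (auto simp: hom1_def hom2_def)

lemma hcomp_id2' [simp]:
  assumes "X \<in> cells1 K" "Y \<in> cells1 K" "src K X = trg K Y"
  shows "\<iota> X \<star> \<iota> Y = \<iota> (X \<cdot> Y)"
  using assms hcomp_id2[of Y "src K Y" "trg K Y" X "trg K X"] by (auto simp: hom1_def)

text \<open>Rebracketing to the right by \<open>hcomp_assoc'\<close> would leave two adjacent
  identity cells unfused. This rule fuses them, so that in normal form a whiskered cell carries at
  most one identity on its left.\<close>

lemma whisker_whisker [simp]:
  assumes "X \<in> cells1 K" "Y \<in> cells1 K" "f \<in> cells2 K" "src K X = trg K Y"
    "src K Y = trg K (dom2 K f)"
  shows "\<iota> X \<star> (\<iota> Y \<star> f) = \<iota> (X \<cdot> Y) \<star> f"
  using assms by (simp flip: hcomp_assoc' hcomp_id2')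

lemma interchange':
  assumes "f \<in> cells2 K" "g \<in> cells2 K" "f' \<in> cells2 K" "g' \<in> cells2 K"
    "dom2 K g = cod2 K f" "dom2 K g' = cod2 K f'" "src K (dom2 K f) = trg K (dom2 K f')"
  shows "(g \<bullet> f) \<star> (g' \<bullet> f') = (g \<star> g') \<bullet> (f \<star> f')"
  using assms dom2_closed
    interchange[of "dom2 K f'" "src K (dom2 K f')" "trg K (dom2 K f')" "dom2 K f" "trg K (dom2 K f)"
      f' "cod2 K f'" g' "cod2 K g'" f "cod2 K f" g "cod2 K g"]
  by (auto simp: hom1_def hom2_def)

lemma whisker_vcomp [simp]:
  assumes "f \<in> cells2 K" "g \<in> cells2 K" "X \<in> cells1 K" "dom2 K g = cod2 K f"
  shows "src K X = trg K (dom2 K f) \<Longrightarrow> \<iota> X \<star> (g \<bullet> f) = (\<iota> X \<star> g) \<bullet> (\<iota> X \<star> f)"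
    "src K (dom2 K f) = trg K X \<Longrightarrow> (g \<bullet> f) \<star> \<iota> X = (g \<star> \<iota> X) \<bullet> (f \<star> \<iota> X)"
  using assms interchange'[of "\<iota> X" "\<iota> X" f g] interchange'[of f g "\<iota> X" "\<iota> X"] by auto

text \<open>The simplification rules so far bring 2-cells into a normal form of vertical composites of
  whiskered cells.  They leave the order of the factors alone; that is changed by \<open>slide\<close>.\<close>

lemma hcomp_slices:
  assumes "f \<in> hom2 K X X'" "g \<in> hom2 K Y Y'" "src K X = trg K Y"
  shows "f \<star> g = (f \<star> \<iota> Y') \<bullet> (\<iota> X \<star> g)" "f \<star> g = (\<iota> X' \<star> g) \<bullet> (f \<star> \<iota> Y)"
proof -
  have "X \<in> cells1 K" "X' \<in> cells1 K" "Y \<in> cells1 K" "Y' \<in> cells1 K" "src K X' = src K X"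
    "trg K Y' = trg K Y"
    using assms dom2_closed[of f] cod2_closed[of f] dom2_closed[of g] cod2_closed[of g]
     src_parallel[of f] trg_parallel[of g]
    by (auto simp: hom2_def)
  then show "f \<star> g = (f \<star> \<iota> Y') \<bullet> (\<iota> X \<star> g)" "f \<star> g = (\<iota> X' \<star> g) \<bullet> (f \<star> \<iota> Y)"
    using assms interchange'[of "\<iota> X" f g "\<iota> Y'"] interchange'[of f "\<iota> X'" "\<iota> Y" g]
    by (auto simp: hom2_def)
qed

lemma slide:
  assumes "f \<in> hom2 K X X'" "g \<in> hom2 K Y Y'" "src K X = trg K Y"
  shows "(f \<star> \<iota> Y') \<bullet> (\<iota> X \<star> g) = (\<iota> X' \<star> g) \<bullet> (f \<star> \<iota> Y)"
  using hcomp_slices[OF assms] by simp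

text \<open>Vertical composites are kept nested to the right, so an equation for
  \<open>g \<bullet> f\<close> matches only at the end of a chain. This form applies it when a
  further cell \<open>h\<close> comes before \<open>f\<close>.\<close>

lemma vcomp_tail:
  assumes "g \<bullet> f = t" "f \<in> cells2 K" "g \<in> cells2 K" "h \<in> cells2 K"
    "dom2 K g = cod2 K f" "dom2 K f = cod2 K h"
  shows "g \<bullet> f \<bullet> h = t \<bullet> h"
  using assms by (metis vcomp_assoc')

text \<open>The simplifier distributes whiskering over vertical composites. Accordingly an equation
  is whiskered here with its left side already distributed, ready for use as a rewrite rule.\<close>

lemma whisker_eq:
  assumes "g \<bullet> f = t" "f \<in> cells2 K" "g \<in> cells2 K" "dom2 K g = cod2 K f" "X \<in> cells1 K"
  shows "src K X = trg K (dom2 K f) \<Longrightarrow> (\<iota> X \<star> g) \<bullet> (\<iota> X \<star> f) = \<iota> X \<star> t"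
    "src K (dom2 K f) = trg K X \<Longrightarrow> (g \<star> \<iota> X) \<bullet> (f \<star> \<iota> X) = t \<star> \<iota> X"
  using assms by auto

end

section \<open>Modules and Eilenberg--Moore 2-cells\<close>

context monad_in
begin

lemma monad_cell [simp]:
  "B \<in> cells1 K" "src K B = A" "trg K B = A" "A \<in> cells0 K"
  "\<mu> \<in> cells2 K" "dom2 K \<mu> = B \<cdot> B" "cod2 K \<mu> = B"
  "\<eta> \<in> cells2 K" "dom2 K \<eta> = id1 K A" "cod2 K \<eta> = B"
  using base_closed endo mult_hom unit_hom by (auto simp: hom1_def hom2_def)

abbreviation Mod where "Mod \<equiv> modules_cat K A B \<mu> \<eta>"
abbreviation EM where "EM \<equiv> EM_endo_cat K A B \<mu> \<eta>"
abbreviation T where "T \<equiv> T_cat K A B \<mu> \<eta>"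
abbreviation endos where "endos \<equiv> twisted_endos K A B \<mu> \<eta>"

section \<open>Modules, their morphisms, and twisted endo-1-cells in terms of cells\<close>

lemma Mod_simps [simp]:
  "Dom Mod = source" "Cod Mod = target" "Ident Mod (M, \<nu>) = Arrow (M, \<nu>) (\<iota> M) (M, \<nu>)"
  "g \<circ>\<^bsub>Mod\<^esub> f = Arrow (source f) (cell g \<bullet> cell f) (target g)"
  by (simp_all add: modules_cat_def Let_def)

lemma Mod_Obj_iff:
  "(M, \<nu>) \<in> Obj Mod \<longleftrightarrow> M \<in> cells1 K \<and> trg K M = A \<and> \<nu> \<in> cells2 K \<and> dom2 K \<nu> = B \<cdot> M \<and>
    cod2 K \<nu> = M \<and> \<nu> \<bullet> (\<mu> \<star> \<iota> M) = \<nu> \<bullet> (\<iota> B \<star> \<nu>) \<and> \<nu> \<bullet> (\<eta> \<star> \<iota> M) = \<iota> M"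
  by (auto simp: modules_cat_def Let_def hom2_def)

lemma Mod_ObjD:
  assumes "(M, \<nu>) \<in> Obj Mod"
  shows "M \<in> cells1 K" "trg K M = A" "\<nu> \<in> cells2 K" "dom2 K \<nu> = B \<cdot> M" "cod2 K \<nu> = M"
  using assms by (auto simp: Mod_Obj_iff)

lemma Mod_Hom_iff:
  "f \<in> Hom Mod (M, \<nu>) (N, \<nu>') \<longleftrightarrow> (M, \<nu>) \<in> Obj Mod \<and> (N, \<nu>') \<in> Obj Mod \<and>
    (\<exists>k. f = Arrow (M, \<nu>) k (N, \<nu>') \<and> k \<in> cells2 K \<and> dom2 K k = M \<and> cod2 K k = N \<and>
      k \<bullet> \<nu> = \<nu>' \<bullet> (\<iota> B \<star> k))"
  unfolding Hom_def by (auto simp: modules_cat_def Let_def hom2_def)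

lemma regular_module: "(B, \<mu>) \<in> Obj Mod"
  by (simp add: Mod_Obj_iff mult_assoc mult_unit_left)

lemma endos_iff:
  "(X, \<psi>) \<in> endos \<longleftrightarrow> X \<in> cells1 K \<and> src K X = A \<and> trg K X = A \<and> \<psi> \<in> cells2 K \<and>
    dom2 K \<psi> = B \<cdot> X \<and> cod2 K \<psi> = X \<cdot> B \<and>
    \<psi> \<bullet> (\<mu> \<star> \<iota> X) = (\<iota> X \<star> \<mu>) \<bullet> (\<psi> \<star> \<iota> B) \<bullet> (\<iota> B \<star> \<psi>) \<and> \<psi> \<bullet> (\<eta> \<star> \<iota> X) = \<iota> X \<star> \<eta>"
  by (auto simp: twisted_endos_def hom1_def hom2_def)

lemma endosD:
  assumes "(X, \<psi>) \<in> endos"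
  shows "X \<in> cells1 K" "src K X = A" "trg K X = A" "\<psi> \<in> cells2 K" "dom2 K \<psi> = B \<cdot> X"
    "cod2 K \<psi> = X \<cdot> B"
  using assms by (auto simp: endos_iff)

section \<open>Calculus of the 2-cells induced on modules\<close>

definition induced :: "'f \<Rightarrow> 't \<Rightarrow> 'f \<times> 't \<Rightarrow> 't"
  where "induced Y \<sigma> = (\<lambda>(M, \<nu>). (\<iota> Y \<star> \<nu>) \<bullet> (\<sigma> \<star> \<iota> M))"

text \<open>The lifted action of \<open>B\<close> on \<open>X \<cdot> M\<close>. The formula is that
  of \<open>induced\<close>, applied to the twist as a cell from \<open>B \<cdot> X\<close> to
  \<open>X \<cdot> B\<close>.\<close>

definition act_cell :: "'f \<times> 't \<Rightarrow> 'f \<times> 't \<Rightarrow> 't"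
  where "act_cell = (\<lambda>(X, \<psi>) (M, \<nu>). (\<iota> X \<star> \<nu>) \<bullet> (\<psi> \<star> \<iota> M))"

definition EM_vcomp :: "'f \<Rightarrow> 't \<Rightarrow> 't \<Rightarrow> 't"
  where "EM_vcomp Z \<tau> \<sigma> = (\<iota> Z \<star> \<mu>) \<bullet> (\<tau> \<star> \<iota> B) \<bullet> \<sigma>"

text \<open>Only the typing of an Eilenberg-Moore 2-cell, without its compatibility with the twists:
  a Kleisli arrow for the monad given by composing endo-1-cells with \<open>B\<close> on the right.
  The calculus of \<open>induced\<close> thus also covers cells whose compatibility has not been
  established.\<close>

definition kleisli_cell :: "'f \<Rightarrow> 'f \<Rightarrow> 't \<Rightarrow> bool"
  where "kleisli_cell X Y \<sigma> \<longleftrightarrow> X \<in> cells1 K \<and> src K X = A \<and> trg K X = A \<and>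
    Y \<in> cells1 K \<and> src K Y = A \<and> trg K Y = A \<and>
    \<sigma> \<in> cells2 K \<and> dom2 K \<sigma> = X \<and> cod2 K \<sigma> = Y \<cdot> B"

lemma module_whiskered:
  assumes "(M, \<nu>) \<in> Obj Mod" "X \<in> cells1 K" "src K X = A"
  shows "(\<iota> X \<star> \<nu>) \<bullet> (\<iota> X \<star> \<mu> \<star> \<iota> M) = (\<iota> X \<star> \<nu>) \<bullet> (\<iota> (X \<cdot> B) \<star> \<nu>)"
    "(\<iota> X \<star> \<nu>) \<bullet> (\<iota> X \<star> \<eta> \<star> \<iota> M) = \<iota> (X \<cdot> M)"
proof -
  note [simp] = Mod_ObjD[OF assms(1)] assms(2,3)
  have "\<nu> \<bullet> (\<mu> \<star> \<iota> M) = \<nu> \<bullet> (\<iota> B \<star> \<nu>)" "\<nu> \<bullet> (\<eta> \<star> \<iota> M) = \<iota> M"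
    using assms by (simp_all add: Mod_Obj_iff)
  from this[THEN whisker_eq(1), of X]
  show "(\<iota> X \<star> \<nu>) \<bullet> (\<iota> X \<star> \<mu> \<star> \<iota> M) = (\<iota> X \<star> \<nu>) \<bullet> (\<iota> (X \<cdot> B) \<star> \<nu>)"
    "(\<iota> X \<star> \<nu>) \<bullet> (\<iota> X \<star> \<eta> \<star> \<iota> M) = \<iota> (X \<cdot> M)"
    by simp_all
qed

text \<open>On the right, \<open>\<tau>\<close> slides past the first use of \<open>\<nu>\<close>,
  which leaves two successive actions on \<open>M\<close>. Associativity of \<open>\<nu>\<close>
  makes them one action after the multiplication \<open>\<mu>\<close> that occurs in
  \<open>EM_vcomp\<close>.\<close>

lemma induced_vcomp:
  assumes "kleisli_cell X Y \<sigma>" "kleisli_cell Y Z \<tau>" "(M, \<nu>) \<in> Obj Mod"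
  shows "induced Z (EM_vcomp Z \<tau> \<sigma>) (M, \<nu>) = induced Z \<tau> (M, \<nu>) \<bullet> induced Y \<sigma> (M, \<nu>)"
proof -
  note [simp] = Mod_ObjD[OF assms(3)]
  have s: "(\<tau> \<star> \<iota> M) \<bullet> (\<iota> Y \<star> \<nu>) = (\<iota> (Z \<cdot> B) \<star> \<nu>) \<bullet> (\<tau> \<star> \<iota> (B \<cdot> M))"
    by (rule slide) (use assms in \<open>auto simp: kleisli_cell_def hom2_def\<close>)
  show ?thesis
    using assms(1,2)
    by (simp add: kleisli_cell_def induced_def EM_vcomp_def vcomp_tail[OF s]
       vcomp_tail[OF module_whiskered(1)[OF assms(3)]])
qed


lemma EM_Hom_iff:
  "f \<in> Hom EM (X, \<psi>) (Y, \<psi>') \<longleftrightarrow> (X, \<psi>) \<in> endos \<and> (Y, \<psi>') \<in> endos \<and>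
    (\<exists>\<sigma>. f = Arrow (X, \<psi>) \<sigma> (Y, \<psi>') \<and> \<sigma> \<in> cells2 K \<and> dom2 K \<sigma> = X \<and> cod2 K \<sigma> = Y \<cdot> B \<and>
      (\<iota> Y \<star> \<mu>) \<bullet> (\<sigma> \<star> \<iota> B) \<bullet> \<psi> = (\<iota> Y \<star> \<mu>) \<bullet> (\<psi>' \<star> \<iota> B) \<bullet> (\<iota> B \<star> \<sigma>))"
  unfolding Hom_def by (auto simp: EM_endo_cat_def Let_def hom2_def)

lemma T_Hom_iff:
  "f \<in> Hom T (X, \<psi>) (Y, \<psi>') \<longleftrightarrow> (X, \<psi>) \<in> endos \<and> (Y, \<psi>') \<in> endos \<and>
    (\<exists>\<zeta>. f = Arrow (X, \<psi>) \<zeta> (Y, \<psi>') \<and> \<zeta> \<in> cells2 K \<and> dom2 K \<zeta> = X \<and> cod2 K \<zeta> = Y \<and>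
      (\<zeta> \<star> \<iota> B) \<bullet> \<psi> = \<psi>' \<bullet> (\<iota> B \<star> \<zeta>))"
  unfolding Hom_def by (auto simp: T_cat_def Let_def hom2_def)

lemma EM_HomD:
  assumes "f \<in> Hom EM (X, \<psi>) (Y, \<psi>')"
  shows "kleisli_cell X Y (cell f)"
  using assms by (auto simp: EM_Hom_iff kleisli_cell_def endos_iff)

lemma induced_id:
  assumes "X \<in> cells1 K" "src K X = A" "(M, \<nu>) \<in> Obj Mod"
  shows "induced X (\<iota> X \<star> \<eta>) (M, \<nu>) = \<iota> (X \<cdot> M)"
  using assms Mod_ObjD[OF assms(3)] module_whiskered(2)[OF assms(3)] by (simp add: induced_def)

lemma monad_whiskered:
  assumes "X \<in> cells1 K" "src K X = A"
  shows "(\<iota> X \<star> \<mu>) \<bullet> (\<iota> (X \<cdot> B) \<star> \<eta>) = \<iota> (X \<cdot> B)"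
  using assms whisker_eq(1)[OF mult_unit_right, of X] by simp

text \<open>The unit slides past \<open>\<sigma>\<close> and meets \<open>\<mu>\<close>, where the
  right unit law cancels it. This is the injectivity of \<open>induced\<close> on the regular
  module, with an explicit left inverse.\<close>

lemma induced_regular:
  assumes "kleisli_cell X Y \<sigma>"
  shows "induced Y \<sigma> (B, \<mu>) \<bullet> (\<iota> X \<star> \<eta>) = \<sigma>"
proof -
  have s: "(\<sigma> \<star> \<iota> B) \<bullet> (\<iota> X \<star> \<eta>) = (\<iota> (Y \<cdot> B) \<star> \<eta>) \<bullet> (\<sigma> \<star> \<iota> (id1 K A))"
    by (rule slide) (use assms in \<open>auto simp: kleisli_cell_def hom2_def\<close>)
  show ?thesis
    using assms by (simp add: kleisli_cell_def induced_def s vcomp_tail[OF monad_whiskered])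
qed

text \<open>The cell \<open>\<sigma>\<close> touches only the factor to the left of the module, so
  it interchanges with the module map. What remains is the linearity of that map, whiskered by
  \<open>Y\<close>.\<close>

lemma induced_natural:
  assumes "kleisli_cell X Y \<sigma>" "f \<in> Hom Mod (M, \<nu>) (N, \<nu>')"
  shows "induced Y \<sigma> (N, \<nu>') \<bullet> (\<iota> X \<star> cell f) = (\<iota> Y \<star> cell f) \<bullet> induced Y \<sigma> (M, \<nu>)"
proof -
  obtain k where k: "f = Arrow (M, \<nu>) k (N, \<nu>')" "k \<in> cells2 K" "dom2 K k = M" "cod2 K k = N"
      "k \<bullet> \<nu> = \<nu>' \<bullet> (\<iota> B \<star> k)" and M: "(M, \<nu>) \<in> Obj Mod" "(N, \<nu>') \<in> Obj Mod"
    using assms(2) by (auto simp: Mod_Hom_iff)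
  note [simp] = k(1-4) M[THEN Mod_ObjD(1)] M[THEN Mod_ObjD(2)] M[THEN Mod_ObjD(3)]
    M[THEN Mod_ObjD(4)] M[THEN Mod_ObjD(5)]
  have s: "(\<sigma> \<star> \<iota> N) \<bullet> (\<iota> X \<star> k) = (\<iota> (Y \<cdot> B) \<star> k) \<bullet> (\<sigma> \<star> \<iota> M)"
    by (rule slide) (use assms in \<open>auto simp: kleisli_cell_def hom2_def\<close>)
  have l: "(\<iota> Y \<star> \<nu>') \<bullet> (\<iota> (Y \<cdot> B) \<star> k) = (\<iota> Y \<star> k) \<bullet> (\<iota> Y \<star> \<nu>)"
    using assms(1) whisker_eq(1)[OF k(5)[symmetric], of Y] by (simp add: kleisli_cell_def)
  show ?thesis
    using assms(1) by (simp add: kleisli_cell_def induced_def s vcomp_tail[OF l])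
qed

lemma induced_precomp:
  assumes "kleisli_cell X Y \<sigma>" "\<alpha> \<in> cells2 K" "cod2 K \<alpha> = X" "(M, \<nu>) \<in> Obj Mod"
  shows "induced Y (\<sigma> \<bullet> \<alpha>) (M, \<nu>) = induced Y \<sigma> (M, \<nu>) \<bullet> (\<alpha> \<star> \<iota> M)"
  using assms Mod_ObjD[OF assms(4)] src_parallel[of \<alpha>]
  by (simp add: kleisli_cell_def induced_def)

text \<open>Here \<open>\<alpha>\<close> passes the action \<open>\<nu>\<close> by interchange.
  Together with \<open>induced_precomp\<close> this translates equations with plain 2-cells of
  \<open>K\<close> on either side, namely naturality in the objects of the monoidal category and the
  image of its associativity constraint.\<close>

lemma induced_postcomp:
  assumes "kleisli_cell X Y \<sigma>" "\<alpha> \<in> cells2 K" "dom2 K \<alpha> = Y" "cod2 K \<alpha> = Z" "(M, \<nu>) \<in> Obj Mod"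
  shows "induced Z ((\<alpha> \<star> \<iota> B) \<bullet> \<sigma>) (M, \<nu>) = (\<alpha> \<star> \<iota> M) \<bullet> induced Y \<sigma> (M, \<nu>)"
proof -
  note [simp] = Mod_ObjD[OF assms(5)]
  have Z: "Z \<in> cells1 K" "src K Z = A"
    using assms cod2_closed[of \<alpha>] src_parallel[of \<alpha>] by (auto simp: kleisli_cell_def)
  have s: "(\<alpha> \<star> \<iota> M) \<bullet> (\<iota> Y \<star> \<nu>) = (\<iota> Z \<star> \<nu>) \<bullet> (\<alpha> \<star> \<iota> (B \<cdot> M))"
    by (rule slide) (use assms in \<open>auto simp: kleisli_cell_def hom2_def\<close>)
  show ?thesis
    using assms Z by (simp add: kleisli_cell_def induced_def vcomp_tail[OF s])
qed

lemma induced_whisker_left: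
  assumes "kleisli_cell Y Z \<sigma>" "X \<in> cells1 K" "src K X = A" "(M, \<nu>) \<in> Obj Mod"
  shows "induced (X \<cdot> Z) (\<iota> X \<star> \<sigma>) (M, \<nu>) = \<iota> X \<star> induced Z \<sigma> (M, \<nu>)"
  using assms Mod_ObjD[OF assms(4)] by (simp add: kleisli_cell_def induced_def)

text \<open>To act on \<open>Z \<cdot> M\<close>, the \<open>B\<close> produced by
  \<open>\<sigma>\<close> must first be moved past \<open>Z\<close> by the twist. This is the right
  whiskering of the Eilenberg-Moore 2-category, and it is the source of the twist of
  \<open>Z\<close> in the cocycle conditions.\<close>

lemma induced_whisker_right:
  assumes "kleisli_cell X Y \<sigma>" "(Z, \<psi>) \<in> endos" "(M, \<nu>) \<in> Obj Mod"
  shows "induced Y \<sigma> (Z \<cdot> M, act_cell (Z, \<psi>) (M, \<nu>)) =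
    induced (Y \<cdot> Z) ((\<iota> Y \<star> \<psi>) \<bullet> (\<sigma> \<star> \<iota> Z)) (M, \<nu>)"
  using assms Mod_ObjD[OF assms(3)] endosD[OF assms(2)]
  by (simp add: kleisli_cell_def induced_def act_cell_def)

text \<open>The two axioms of a twist, whiskered by \<open>M\<close>, yield the two module axioms
  one by one. For associativity the inner action is slid past the twist so that associativity of
  \<open>\<nu>\<close> applies.\<close>

lemma act_module:
  assumes "(X, \<psi>) \<in> endos" "(M, \<nu>) \<in> Obj Mod"
  shows "(X \<cdot> M, act_cell (X, \<psi>) (M, \<nu>)) \<in> Obj Mod"
proof -
  note [simp] = Mod_ObjD[OF assms(2)] endosD[OF assms(1)]
  have e: "\<psi> \<bullet> (\<mu> \<star> \<iota> X) = (\<iota> X \<star> \<mu>) \<bullet> (\<psi> \<star> \<iota> B) \<bullet> (\<iota> B \<star> \<psi>)"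
    "\<psi> \<bullet> (\<eta> \<star> \<iota> X) = \<iota> X \<star> \<eta>"
    using assms(1) by (auto simp: endos_iff)
  have m: "(\<psi> \<star> \<iota> M) \<bullet> (\<mu> \<star> \<iota> (X \<cdot> M)) =
      (\<iota> X \<star> \<mu> \<star> \<iota> M) \<bullet> (\<psi> \<star> \<iota> (B \<cdot> M)) \<bullet> (\<iota> B \<star> \<psi> \<star> \<iota> M)"
    "(\<psi> \<star> \<iota> M) \<bullet> (\<eta> \<star> \<iota> (X \<cdot> M)) = \<iota> X \<star> \<eta> \<star> \<iota> M"
    using e[THEN whisker_eq(2), of M] by simp_all
  have s: "(\<psi> \<star> \<iota> M) \<bullet> (\<iota> (B \<cdot> X) \<star> \<nu>) = (\<iota> (X \<cdot> B) \<star> \<nu>) \<bullet> (\<psi> \<star> \<iota> (B \<cdot> M))"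
    by (rule slide) (auto simp: hom2_def)
  show ?thesis
    by (simp add: Mod_Obj_iff act_cell_def m module_whiskered[OF assms(2)] vcomp_tail[OF s]
      vcomp_tail[OF module_whiskered(1)[OF assms(2)]])
qed

lemma act_hom:
  assumes "f \<in> Hom T (X, \<psi>) (Y, \<psi>')" "g \<in> Hom Mod (M, \<nu>) (N, \<nu>')"
  shows "(cell f \<star> cell g) \<bullet> act_cell (X, \<psi>) (M, \<nu>) =
    act_cell (Y, \<psi>') (N, \<nu>') \<bullet> (\<iota> B \<star> cell f \<star> cell g)"
proof -
  obtain k where k: "g = Arrow (M, \<nu>) k (N, \<nu>')" "k \<in> cells2 K" "dom2 K k = M" "cod2 K k = N"
      "k \<bullet> \<nu> = \<nu>' \<bullet> (\<iota> B \<star> k)" and M: "(M, \<nu>) \<in> Obj Mod" "(N, \<nu>') \<in> Obj Mod"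
    using assms(2) by (auto simp: Mod_Hom_iff)
  obtain \<zeta> where z: "f = Arrow (X, \<psi>) \<zeta> (Y, \<psi>')" "\<zeta> \<in> cells2 K" "dom2 K \<zeta> = X" "cod2 K \<zeta> = Y"
      "(\<zeta> \<star> \<iota> B) \<bullet> \<psi> = \<psi>' \<bullet> (\<iota> B \<star> \<zeta>)" and X: "(X, \<psi>) \<in> endos" "(Y, \<psi>') \<in> endos"
    using assms(1) by (auto simp: T_Hom_iff)
  note [simp] = k(1-4) z(1-4) Mod_ObjD[OF M(1)] Mod_ObjD[OF M(2)] endosD[OF X(1)] endosD[OF X(2)]
  have h: "\<zeta> \<star> k = (\<iota> Y \<star> k) \<bullet> (\<zeta> \<star> \<iota> M)"
    by (rule hcomp_slices) (auto simp: hom2_def)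
  have s: "(\<zeta> \<star> \<iota> M) \<bullet> (\<iota> X \<star> \<nu>) = (\<iota> Y \<star> \<nu>) \<bullet> (\<zeta> \<star> \<iota> (B \<cdot> M))"
    by (rule slide) (auto simp: hom2_def)
  have s': "(\<psi>' \<star> \<iota> N) \<bullet> (\<iota> (B \<cdot> Y) \<star> k) = (\<iota> (Y \<cdot> B) \<star> k) \<bullet> (\<psi>' \<star> \<iota> M)"
    by (rule slide) (auto simp: hom2_def)
  have kY: "(\<iota> Y \<star> k) \<bullet> (\<iota> Y \<star> \<nu>) = (\<iota> Y \<star> \<nu>') \<bullet> (\<iota> (Y \<cdot> B) \<star> k)"
    using whisker_eq(1)[OF k(5), of Y] by simp
  have zM: "(\<zeta> \<star> \<iota> (B \<cdot> M)) \<bullet> (\<psi> \<star> \<iota> M) = (\<psi>' \<star> \<iota> M) \<bullet> (\<iota> B \<star> \<zeta> \<star> \<iota> M)"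
    using whisker_eq(2)[OF z(5), of M] by simp
  show ?thesis
    by (simp add: act_cell_def h vcomp_tail[OF s] vcomp_tail[OF s'] vcomp_tail[OF kY] zM)
qed

text \<open>Associativity of \<open>\<nu>\<close> turns two successive actions on \<open>M\<close>
  into one action after \<open>\<mu>\<close>. With \<open>\<mu>\<close> exposed, both sides are the
  compatibility condition of the Eilenberg-Moore 2-cell, whiskered by \<open>M\<close> and followed
  by the action.\<close>

lemma induced_linear:
  assumes "f \<in> Hom EM (X, \<psi>) (Y, \<psi>')" "(M, \<nu>) \<in> Obj Mod"
  shows "induced Y (cell f) (M, \<nu>) \<bullet> act_cell (X, \<psi>) (M, \<nu>) =
    act_cell (Y, \<psi>') (M, \<nu>) \<bullet> (\<iota> B \<star> induced Y (cell f) (M, \<nu>))"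
proof -
  obtain \<sigma> where z: "f = Arrow (X, \<psi>) \<sigma> (Y, \<psi>')" "\<sigma> \<in> cells2 K" "dom2 K \<sigma> = X" "cod2 K \<sigma> = Y \<cdot> B"
      "(\<iota> Y \<star> \<mu>) \<bullet> (\<sigma> \<star> \<iota> B) \<bullet> \<psi> = (\<iota> Y \<star> \<mu>) \<bullet> (\<psi>' \<star> \<iota> B) \<bullet> (\<iota> B \<star> \<sigma>)"
    and X: "(X, \<psi>) \<in> endos" "(Y, \<psi>') \<in> endos"
    using assms(1) by (auto simp: EM_Hom_iff)
  note [simp] = z(1-4) Mod_ObjD[OF assms(2)] endosD[OF X(1)] endosD[OF X(2)]
  have s: "(\<sigma> \<star> \<iota> M) \<bullet> (\<iota> X \<star> \<nu>) = (\<iota> (Y \<cdot> B) \<star> \<nu>) \<bullet> (\<sigma> \<star> \<iota> (B \<cdot> M))"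
    by (rule slide) (auto simp: hom2_def)
  have s': "(\<psi>' \<star> \<iota> M) \<bullet> (\<iota> (B \<cdot> Y) \<star> \<nu>) = (\<iota> (Y \<cdot> B) \<star> \<nu>) \<bullet> (\<psi>' \<star> \<iota> (B \<cdot> M))"
    by (rule slide) (auto simp: hom2_def)
  have e: "(\<iota> Y \<star> \<mu> \<star> \<iota> M) \<bullet> (\<sigma> \<star> \<iota> (B \<cdot> M)) \<bullet> (\<psi> \<star> \<iota> M) =
      (\<iota> Y \<star> \<mu> \<star> \<iota> M) \<bullet> (\<psi>' \<star> \<iota> (B \<cdot> M)) \<bullet> (\<iota> B \<star> \<sigma> \<star> \<iota> M)"
    using whisker_eq(2)[OF z(5), of M] by simp
  note w = module_whiskered(1)[OF assms(2), of Y]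
  have "induced Y (cell f) (M, \<nu>) \<bullet> act_cell (X, \<psi>) (M, \<nu>) =
      (\<iota> Y \<star> \<nu>) \<bullet> (\<iota> Y \<star> \<mu> \<star> \<iota> M) \<bullet> (\<sigma> \<star> \<iota> (B \<cdot> M)) \<bullet> (\<psi> \<star> \<iota> M)"
    by (simp add: induced_def act_cell_def vcomp_tail[OF s] vcomp_tail[OF w])
  also have "\<dots> = act_cell (Y, \<psi>') (M, \<nu>) \<bullet> (\<iota> B \<star> induced Y (cell f) (M, \<nu>))"
    unfolding e by (simp add: induced_def act_cell_def vcomp_tail[OF s'] vcomp_tail[OF w])
  finally show ?thesis .
qed

section \<open>Recovering Eilenberg-Moore 2-cells from maps on the regular module\<close>

lemma EM_linear_of_regular:
  assumes "(X, \<psi>) \<in> endos" "(Y, \<psi>') \<in> endos" "h \<in> cells2 K" "dom2 K h = X \<cdot> B" "cod2 K h = Y \<cdot> B"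
    "h \<bullet> act_cell (X, \<psi>) (B, \<mu>) = act_cell (Y, \<psi>') (B, \<mu>) \<bullet> (\<iota> B \<star> h)"
    "h = induced Y (h \<bullet> (\<iota> X \<star> \<eta>)) (B, \<mu>)"
  shows "Arrow (X, \<psi>) (h \<bullet> (\<iota> X \<star> \<eta>)) (Y, \<psi>') \<in> Hom EM (X, \<psi>) (Y, \<psi>')"
proof -
  note [simp] = assms(3-5) endosD[OF assms(1)] endosD[OF assms(2)]
  have s: "(\<psi> \<star> \<iota> B) \<bullet> (\<iota> (B \<cdot> X) \<star> \<eta>) = (\<iota> (X \<cdot> B) \<star> \<eta>) \<bullet> (\<psi> \<star> \<iota> (id1 K A))"
    by (rule slide) (auto simp: hom2_def)
  \<comment> \<open>Evaluated at the unit, the action on \<open>X \<cdot> B\<close> is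
    \<open>\<psi>\<close> itself. Linearity of \<open>h\<close> at the unit therefore gives one side
    of the compatibility condition.\<close>
  have "h \<bullet> \<psi> = h \<bullet> act_cell (X, \<psi>) (B, \<mu>) \<bullet> (\<iota> (B \<cdot> X) \<star> \<eta>)"
    by (simp add: act_cell_def s vcomp_tail[OF monad_whiskered])
  also have "\<dots> = (act_cell (Y, \<psi>') (B, \<mu>) \<bullet> (\<iota> B \<star> h)) \<bullet> (\<iota> (B \<cdot> X) \<star> \<eta>)"
    unfolding assms(6)[symmetric] by (simp add: act_cell_def)
  also have "\<dots> = (\<iota> Y \<star> \<mu>) \<bullet> (\<psi>' \<star> \<iota> B) \<bullet> (\<iota> B \<star> (h \<bullet> (\<iota> X \<star> \<eta>)))"
    by (simp add: act_cell_def)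
  finally have *: "h \<bullet> \<psi> = (\<iota> Y \<star> \<mu>) \<bullet> (\<psi>' \<star> \<iota> B) \<bullet> (\<iota> B \<star> (h \<bullet> (\<iota> X \<star> \<eta>)))" .
  \<comment> \<open>The other side comes from \<open>h\<close> being induced by its value at the
    unit.\<close>
  have "h \<bullet> \<psi> = (\<iota> Y \<star> \<mu>) \<bullet> ((h \<bullet> (\<iota> X \<star> \<eta>)) \<star> \<iota> B) \<bullet> \<psi>"
    by (subst assms(7)) (simp add: induced_def)
  then show ?thesis
    using * assms(1,2) by (simp add: EM_Hom_iff)
qed

text \<open>The determination condition speaks of the associativity constraint, not of its inverse;
  this lemma supplies the inverse. An induced map on the regular module commutes with right
  multiplication by \<open>B\<close>, a two-sided inverse of such a map does so too, and a map
  commuting with right multiplication is determined by its value at the unit.\<close>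

lemma induced_inverse:
  assumes "kleisli_cell X Y \<sigma>" "h \<in> cells2 K" "dom2 K h = Y \<cdot> B" "cod2 K h = X \<cdot> B"
    "h \<bullet> induced Y \<sigma> (B, \<mu>) = \<iota> (X \<cdot> B)" "induced Y \<sigma> (B, \<mu>) \<bullet> h = \<iota> (Y \<cdot> B)"
  shows "h = induced X (h \<bullet> (\<iota> Y \<star> \<eta>)) (B, \<mu>)"
proof -
  note [simp] = assms(2-4)
  have [simp]: "X \<in> cells1 K" "src K X = A" "trg K X = A" "Y \<in> cells1 K" "src K Y = A" "trg K Y = A"
    "\<sigma> \<in> cells2 K" "dom2 K \<sigma> = X" "cod2 K \<sigma> = Y \<cdot> B"
    using assms(1) by (auto simp: kleisli_cell_def)
  define r where "r = induced Y \<sigma> (B, \<mu>)"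
  have [simp]: "r \<in> cells2 K" "dom2 K r = X \<cdot> B" "cod2 K r = Y \<cdot> B"
    by (simp_all add: r_def induced_def)
  have hr: "h \<bullet> r = \<iota> (X \<cdot> B)" "r \<bullet> h = \<iota> (Y \<cdot> B)"
    using assms by (simp_all add: r_def)
  have s: "(\<sigma> \<star> \<iota> B) \<bullet> (\<iota> X \<star> \<mu>) = (\<iota> (Y \<cdot> B) \<star> \<mu>) \<bullet> (\<sigma> \<star> \<iota> (B \<cdot> B))"
    by (rule slide) (auto simp: hom2_def)
  \<comment> \<open>Right linearity of \<open>r\<close> over \<open>B\<close>, from associativity of
    \<open>\<mu>\<close>.\<close>
  have r: "(\<iota> Y \<star> \<mu>) \<bullet> (r \<star> \<iota> B) = r \<bullet> (\<iota> X \<star> \<mu>)"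
    by (simp add: r_def induced_def s vcomp_tail[OF module_whiskered(1)[OF regular_module, of Y]])
  \<comment> \<open>The identity is inserted as \<open>r \<bullet> h\<close> under the
    multiplication; right linearity then carries \<open>r\<close> across it, where \<open>h\<close>
    cancels it.\<close>
  have "h \<bullet> (\<iota> Y \<star> \<mu>) = h \<bullet> (\<iota> Y \<star> \<mu>) \<bullet> ((r \<bullet> h) \<star> \<iota> B)"
    unfolding hr by simp
  also have "\<dots> = h \<bullet> r \<bullet> (\<iota> X \<star> \<mu>) \<bullet> (h \<star> \<iota> B)"
    by (simp add: vcomp_tail[OF r])
  also have "\<dots> = (\<iota> X \<star> \<mu>) \<bullet> (h \<star> \<iota> B)"
    by (simp add: vcomp_tail[OF hr(1)])
  finally have h: "(\<iota> X \<star> \<mu>) \<bullet> (h \<star> \<iota> B) = h \<bullet> (\<iota> Y \<star> \<mu>)" by simp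
  show ?thesis
    by (simp add: induced_def vcomp_tail[OF h] module_whiskered(2)[OF regular_module])
qed


section \<open>Isomorphisms of Eilenberg-Moore 2-cells against isomorphisms of modules\<close>

lemma EM_simps [simp]:
  "Dom EM = source" "Cod EM = target" "Ident EM (X, \<psi>) = Arrow (X, \<psi>) (\<iota> X \<star> \<eta>) (X, \<psi>)"
  "g \<circ>\<^bsub>EM\<^esub> f = Arrow (source f) (EM_vcomp (fst (target g)) (cell g) (cell f)) (target g)"
  by (simp_all add: EM_endo_cat_def EM_vcomp_def)

lemma EM_eqI:
  assumes "kleisli_cell X Y \<sigma>" "kleisli_cell X Y \<sigma>'" "induced Y \<sigma> (B, \<mu>) = induced Y \<sigma>' (B, \<mu>)"
  shows "\<sigma> = \<sigma>'"
  using assms induced_regular by metis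

lemma kleisli_cell_vcomp:
  assumes "kleisli_cell X Y \<sigma>" "kleisli_cell Y Z \<tau>"
  shows "kleisli_cell X Z (EM_vcomp Z \<tau> \<sigma>)"
  using assms by (simp add: kleisli_cell_def EM_vcomp_def)

lemma induced_cell:
  assumes "kleisli_cell X Y \<sigma>" "(M, \<nu>) \<in> Obj Mod"
  shows "induced Y \<sigma> (M, \<nu>) \<in> cells2 K" "dom2 K (induced Y \<sigma> (M, \<nu>)) = X \<cdot> M"
    "cod2 K (induced Y \<sigma> (M, \<nu>)) = Y \<cdot> M"
  using assms Mod_ObjD[OF assms(2)] by (simp_all add: kleisli_cell_def induced_def)

lemma induced_hom:
  assumes "f \<in> Hom EM (X, \<psi>) (Y, \<psi>')" "(M, \<nu>) \<in> Obj Mod"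
  shows "Arrow (X \<cdot> M, act_cell (X, \<psi>) (M, \<nu>)) (induced Y (cell f) (M, \<nu>))
      (Y \<cdot> M, act_cell (Y, \<psi>') (M, \<nu>))
    \<in> Hom Mod (X \<cdot> M, act_cell (X, \<psi>) (M, \<nu>)) (Y \<cdot> M, act_cell (Y, \<psi>') (M, \<nu>))"
proof -
  have "(X, \<psi>) \<in> endos" "(Y, \<psi>') \<in> endos"
    using assms by (auto simp: EM_Hom_iff)
  then show ?thesis
    using assms induced_linear[OF assms] induced_cell[OF EM_HomD[OF assms(1)] assms(2)]
    by (simp add: Mod_Hom_iff act_module)
qed

lemma induced_iso:
  assumes "f \<in> isos EM (X, \<psi>) (Y, \<psi>')" "(M, \<nu>) \<in> Obj Mod"
  shows "Arrow (X \<cdot> M, act_cell (X, \<psi>) (M, \<nu>)) (induced Y (cell f) (M, \<nu>))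
      (Y \<cdot> M, act_cell (Y, \<psi>') (M, \<nu>))
    \<in> isos Mod (X \<cdot> M, act_cell (X, \<psi>) (M, \<nu>)) (Y \<cdot> M, act_cell (Y, \<psi>') (M, \<nu>))"
proof -
  obtain g where f: "f \<in> Hom EM (X, \<psi>) (Y, \<psi>')" and g: "g \<in> Hom EM (Y, \<psi>') (X, \<psi>)"
    and gf: "g \<circ>\<^bsub>EM\<^esub> f = Ident EM (X, \<psi>)" and fg: "f \<circ>\<^bsub>EM\<^esub> g = Ident EM (Y, \<psi>')"
    using assms(1) by (auto simp: isos_def)
  have X: "(X, \<psi>) \<in> endos" "(Y, \<psi>') \<in> endos" and t: "target f = (Y, \<psi>')" "target g = (X, \<psi>)"
    using f g by (auto simp: EM_Hom_iff)
  have "induced X (cell g) (M, \<nu>) \<bullet> induced Y (cell f) (M, \<nu>) = \<iota> (X \<cdot> M)"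
    using induced_vcomp[OF EM_HomD[OF f] EM_HomD[OF g] assms(2)] gf t
      induced_id[OF _ _ assms(2), of X] endosD[OF X(1)] by simp
  moreover have "induced Y (cell f) (M, \<nu>) \<bullet> induced X (cell g) (M, \<nu>) = \<iota> (Y \<cdot> M)"
    using induced_vcomp[OF EM_HomD[OF g] EM_HomD[OF f] assms(2)] fg t
      induced_id[OF _ _ assms(2), of Y] endosD[OF X(2)] by simp
  ultimately show ?thesis
    unfolding isos_def
    by (auto intro!: induced_hom[OF f assms(2)] bexI[OF _ induced_hom[OF g assms(2)]])
qed

text \<open>Both the map and its inverse on the regular module are induced, the latter by
  \<open>induced_inverse\<close>. Hence both come from Eilenberg-Moore 2-cells, and the two inverse
  laws hold because \<open>induced\<close> is injective and compatible with composition.\<close>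

lemma EM_iso_of_regular:
  assumes "(X, \<psi>) \<in> endos" "(Y, \<psi>') \<in> endos"
    "f \<in> isos Mod (X \<cdot> B, act_cell (X, \<psi>) (B, \<mu>)) (Y \<cdot> B, act_cell (Y, \<psi>') (B, \<mu>))"
    "cell f = induced Y (cell f \<bullet> (\<iota> X \<star> \<eta>)) (B, \<mu>)"
  shows "Arrow (X, \<psi>) (cell f \<bullet> (\<iota> X \<star> \<eta>)) (Y, \<psi>') \<in> isos EM (X, \<psi>) (Y, \<psi>')"
proof -
  note [simp] = endosD[OF assms(1)] endosD[OF assms(2)]
  define h where "h = cell f"
  obtain k where h: "h \<in> cells2 K" "dom2 K h = X \<cdot> B" "cod2 K h = Y \<cdot> B"
      "h \<bullet> act_cell (X, \<psi>) (B, \<mu>) = act_cell (Y, \<psi>') (B, \<mu>) \<bullet> (\<iota> B \<star> h)"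
    and k: "k \<in> cells2 K" "dom2 K k = Y \<cdot> B" "cod2 K k = X \<cdot> B"
      "k \<bullet> act_cell (Y, \<psi>') (B, \<mu>) = act_cell (X, \<psi>) (B, \<mu>) \<bullet> (\<iota> B \<star> k)"
    and kh: "k \<bullet> h = \<iota> (X \<cdot> B)" and hk: "h \<bullet> k = \<iota> (Y \<cdot> B)"
    using assms(3) unfolding isos_def h_def by (auto simp: Mod_Hom_iff)
  define \<sigma> where "\<sigma> = h \<bullet> (\<iota> X \<star> \<eta>)"
  \<comment> \<open>The candidate inverse is the value at the unit of the inverse module
    map.\<close>
  define \<tau> where "\<tau> = k \<bullet> (\<iota> Y \<star> \<eta>)"
  have s: "kleisli_cell X Y \<sigma>" and t: "kleisli_cell Y X \<tau>"
    using h k by (simp_all add: kleisli_cell_def \<sigma>_def \<tau>_def)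
  have hs: "h = induced Y \<sigma> (B, \<mu>)"
    using assms(4) by (simp add: h_def \<sigma>_def)
  have kt: "k = induced X \<tau> (B, \<mu>)"
    unfolding \<tau>_def by (rule induced_inverse[OF s k(1-3)]) (simp_all add: hk kh flip: hs)
  have "Arrow (X, \<psi>) \<sigma> (Y, \<psi>') \<in> Hom EM (X, \<psi>) (Y, \<psi>')"
    unfolding \<sigma>_def by (rule EM_linear_of_regular[OF assms(1,2) h hs[unfolded \<sigma>_def]])
  moreover have "Arrow (Y, \<psi>') \<tau> (X, \<psi>) \<in> Hom EM (Y, \<psi>') (X, \<psi>)"
    unfolding \<tau>_def by (rule EM_linear_of_regular[OF assms(2,1) k kt[unfolded \<tau>_def]])
  moreover have "EM_vcomp X \<tau> \<sigma> = \<iota> X \<star> \<eta>"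
    by (rule EM_eqI[OF kleisli_cell_vcomp[OF s t]])
      (simp_all add: kleisli_cell_def induced_vcomp[OF s t] regular_module induced_id kh flip: hs kt)
  moreover have "EM_vcomp Y \<sigma> \<tau> = \<iota> Y \<star> \<eta>"
    by (rule EM_eqI[OF kleisli_cell_vcomp[OF t s]])
      (simp_all add: kleisli_cell_def induced_vcomp[OF t s] regular_module induced_id hk flip: hs kt)
  ultimately show ?thesis
    unfolding isos_def h_def[symmetric] \<sigma>_def[symmetric]
    by (auto intro!: bexI[of _ "Arrow (Y, \<psi>') \<tau> (X, \<psi>)"])
qed

section \<open>The category of modules\<close>

lemma Mod_Obj_of_Arr:
  assumes "f \<in> Arr Mod"
  shows "source f \<in> Obj Mod" "target f \<in> Obj Mod"
  using assms by (auto simp: modules_cat_def Let_def)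

lemma category_Mod: "category Mod"
proof
  fix f assume "f \<in> Arr Mod"
  then show "Dom Mod f \<in> Obj Mod" "Cod Mod f \<in> Obj Mod"
    by (simp_all add: Mod_Obj_of_Arr)
next
  fix M assume "M \<in> Obj Mod"
  then show "Ident Mod M \<in> Hom Mod M M"
    by (cases M) (auto simp: Mod_Hom_iff Mod_ObjD)
next
  fix f g L M N
  assume "f \<in> Hom Mod L M" "g \<in> Hom Mod M N"
  moreover obtain L' \<chi> M' \<nu> N' \<xi> where e: "L = (L', \<chi>)" "M = (M', \<nu>)" "N = (N', \<xi>)"
    by (metis surj_pair)
  ultimately obtain k h where k: "f = Arrow (L', \<chi>) k (M', \<nu>)" "k \<in> cells2 K" "dom2 K k = L'"
      "cod2 K k = M'" "k \<bullet> \<chi> = \<nu> \<bullet> (\<iota> B \<star> k)" and L: "(L', \<chi>) \<in> Obj Mod"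
    and h: "g = Arrow (M', \<nu>) h (N', \<xi>)" "h \<in> cells2 K" "dom2 K h = M'" "cod2 K h = N'"
      "h \<bullet> \<nu> = \<xi> \<bullet> (\<iota> B \<star> h)" and M: "(M', \<nu>) \<in> Obj Mod" and N: "(N', \<xi>) \<in> Obj Mod"
    by (auto simp: Mod_Hom_iff)
  show "g \<circ>\<^bsub>Mod\<^esub> f \<in> Hom Mod L N"
    using L M N h(1-4) k Mod_ObjD[OF L] Mod_ObjD[OF M] Mod_ObjD[OF N] e
    by (simp add: Mod_Hom_iff vcomp_tail[OF h(5)])
next
  fix f M N assume "f \<in> Hom Mod M N"
  then show "f \<circ>\<^bsub>Mod\<^esub> Ident Mod M = f" "Ident Mod N \<circ>\<^bsub>Mod\<^esub> f = f"
    by (cases M; cases N; auto simp: Mod_Hom_iff)+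
next
  fix f g h L M N P
  assume "f \<in> Hom Mod L M" "g \<in> Hom Mod M N" "h \<in> Hom Mod N P"
  then show "(h \<circ>\<^bsub>Mod\<^esub> g) \<circ>\<^bsub>Mod\<^esub> f = h \<circ>\<^bsub>Mod\<^esub> (g \<circ>\<^bsub>Mod\<^esub> f)"
    by (cases L; cases M; cases N; cases P) (auto simp: Mod_Hom_iff)
qed

end

section \<open>The action on modules\<close>

locale lifted_objects = monad_in K A B \<mu> \<eta> + quasi_monoidal_functor C "T_cat K A B \<mu> \<eta>" F
  for K :: "('o, 'f, 't, 'z) two_cat_scheme" (structure) and A B \<mu> \<eta>
    and C :: "('c, 'm, 'y) moncat_scheme"
    and F :: "('c, 'm, 'f \<times> 't, ('f \<times> 't, 't) arrow) fctr" +
  assumes unit_constraints: "identity_unit_constraints C"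
begin

abbreviation act where "act \<equiv> module_act K C F"
abbreviation cr where "cr \<equiv> carrier1 F"
abbreviation tw where "tw \<equiv> twist F"

section \<open>Carriers, twists and underlying 2-cells of the functor \<open>F\<close>\<close>

lemma T_simps [simp]:
  "Obj T = endos" "tens T = tens_twisted K" "unit_obj T = (id1 K A, \<iota> B)"
  "Ident T (X, \<psi>) = Arrow (X, \<psi>) (\<iota> X) (X, \<psi>)"
  "f \<boxtimes>\<^bsub>T\<^esub> g = Arrow (tens_twisted K (source f) (source g)) (cell f \<star> cell g)
      (tens_twisted K (target f) (target g))"
  "g \<circ>\<^bsub>T\<^esub> f = Arrow (source f) (cell g \<bullet> cell f) (target g)"
  by (simp_all add: T_cat_def Let_def)

lemma obj_map_eq: "obj_map F X = (cr X, tw X)"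
  by (simp add: carrier1_def twist_def)

lemma twisted_endo: "X \<in> Obj C \<Longrightarrow> (cr X, tw X) \<in> endos"
  using map_obj[of X] by (simp add: obj_map_eq)

lemma cr_cell [simp]:
  assumes "X \<in> Obj C"
  shows "cr X \<in> cells1 K" "src K (cr X) = A" "trg K (cr X) = A" "tw X \<in> cells2 K"
    "dom2 K (tw X) = B \<cdot> cr X" "cod2 K (tw X) = cr X \<cdot> B"
  using endosD[OF twisted_endo[OF assms]] by auto

lemma tens_closed [simp]: "X \<in> Obj C \<Longrightarrow> Y \<in> Obj C \<Longrightarrow> X \<otimes>\<^bsub>C\<^esub> Y \<in> Obj C"
  using is_functor.map_obj[OF C.tensor_is_functor, of "(X, Y)"]
  by (simp add: prod_cat_def tensor_functor_def)

lemma tens_hom: "f \<in> Hom C X X' \<Longrightarrow> g \<in> Hom C Y Y' \<Longrightarrow> f \<boxtimes>\<^bsub>C\<^esub> g \<in> Hom C (X \<otimes>\<^bsub>C\<^esub> Y) (X' \<otimes>\<^bsub>C\<^esub> Y')"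
  using is_functor.map_hom[OF C.tensor_is_functor, of "(f, g)" "(X, Y)" "(X', Y')"]
  by (simp add: Hom_prod_cat tensor_functor_def)

lemma cr_tens [simp]:
  assumes "X \<in> Obj C" "Y \<in> Obj C"
  shows "cr (X \<otimes>\<^bsub>C\<^esub> Y) = cr X \<cdot> cr Y"
    "tw (X \<otimes>\<^bsub>C\<^esub> Y) = (\<iota> (cr X) \<star> tw Y) \<bullet> (tw X \<star> \<iota> (cr Y))"
  using map_tens[OF assms] by (simp_all add: obj_map_eq tens_twisted_def)

lemma cr_unit [simp]: "cr \<one>\<^bsub>C\<^esub> = id1 K A" "tw \<one>\<^bsub>C\<^esub> = \<iota> B"
  using map_unit by (simp_all add: obj_map_eq)

lemma unit_closed [simp]: "\<one>\<^bsub>C\<^esub> \<in> Obj C"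
  by (rule C.unit_closed)

lemma unit_simps [simp]:
  assumes "X \<in> Obj C"
  shows "\<one>\<^bsub>C\<^esub> \<otimes>\<^bsub>C\<^esub> X = X" "X \<otimes>\<^bsub>C\<^esub> \<one>\<^bsub>C\<^esub> = X" "lunit C X = Ident C X" "runit C X = Ident C X"
  using unit_constraints assms by (auto simp: identity_unit_constraints_def)

lemma arr_map_hom:
  assumes "f \<in> Hom C X Y"
  shows "arr_map F f \<in> Hom T (cr X, tw X) (cr Y, tw Y)"
  using map_hom[OF assms] by (simp add: obj_map_eq)

lemma carrier2_cell:
  assumes "f \<in> Hom C X Y"
  shows "carrier2 F f \<in> cells2 K" "dom2 K (carrier2 F f) = cr X" "cod2 K (carrier2 F f) = cr Y"
  using arr_map_hom[OF assms] by (auto simp: T_Hom_iff carrier2_def)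

lemma HomD_C:
  assumes "f \<in> Hom C X Y"
  shows "f \<in> Arr C" "Dom C f = X" "Cod C f = Y" "X \<in> Obj C" "Y \<in> Obj C"
  using assms C.dom_closed[of f] C.cod_closed[of f] by (auto simp: Hom_def)

lemma Ident_C [simp]:
  assumes "X \<in> Obj C"
  shows "carrier2 F (Ident C X) = \<iota> (cr X)" "Dom C (Ident C X) = X" "Cod C (Ident C X) = X"
  using map_ident[OF assms] C.ident_hom[OF assms]
  by (simp_all add: carrier2_def obj_map_eq Hom_def)

lemma carrier2_comp:
  assumes "f \<in> Hom C X Y" "g \<in> Hom C Y Z"
  shows "carrier2 F (g \<circ>\<^bsub>C\<^esub> f) = carrier2 F g \<bullet> carrier2 F f"
  using map_comp[OF assms] by (simp add: carrier2_def)

lemma carrier2_tens: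
  assumes "f \<in> Arr C" "g \<in> Arr C"
  shows "carrier2 F (f \<boxtimes>\<^bsub>C\<^esub> g) = carrier2 F f \<star> carrier2 F g"
  using map_tens_arr[OF assms] by (simp add: carrier2_def)

section \<open>The action functor, its unit and its strict associativity on objects\<close>

lemma act_simps:
  "obj_map act (X, (M, \<nu>)) = (cr X \<cdot> M, act_cell (cr X, tw X) (M, \<nu>))"
  "arr_map act (f, k) = Arrow (obj_map act (Dom C f, source k)) (carrier2 F f \<star> cell k)
     (obj_map act (Cod C f, target k))"
  by (simp_all add: module_act_def Let_def act_cell_def)

lemma act_closed [simp]:
  assumes "X \<in> Obj C" "M \<in> Obj Mod"
  shows "obj_map act (X, M) \<in> Obj Mod"
  using assms act_module[OF twisted_endo] by (cases M) (simp add: act_simps(1))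

lemma act_hom_Mod:
  assumes f: "f \<in> Hom C X Y" and k: "k \<in> Hom Mod M N"
  shows "arr_map act (f, k) \<in> Hom Mod (obj_map act (X, M)) (obj_map act (Y, N))"
proof -
  obtain M0 \<nu> N0 \<nu>' where M: "M = (M0, \<nu>)" "N = (N0, \<nu>')" by fastforce
  have MN: "(M0, \<nu>) \<in> Obj Mod" "(N0, \<nu>') \<in> Obj Mod"
    and k': "source k = M" "target k = N" "cell k \<in> cells2 K" "dom2 K (cell k) = M0" "cod2 K (cell k) = N0"
    using k unfolding M by (auto simp: Mod_Hom_iff)
  show ?thesis
    using act_hom[OF arr_map_hom[OF f] k[unfolded M]] carrier2_cell[OF f] HomD_C[OF f] MN
      act_module[OF twisted_endo MN(1), of X] act_module[OF twisted_endo MN(2), of Y] k'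
      Mod_ObjD[OF MN(1)] Mod_ObjD[OF MN(2)]
    by (simp add: act_simps Mod_Hom_iff M flip: carrier2_def)
qed

lemma act_is_functor: "is_functor (prod_cat C Mod) Mod act"
proof -
  interpret PC: category "prod_cat C Mod"
    by (rule category_prod_cat[OF C.category_axioms category_Mod])
  interpret M: category Mod by (rule category_Mod)
  show ?thesis
  proof
    fix P assume "P \<in> Obj (prod_cat C Mod)"
    then obtain X M \<nu> where P: "P = (X, (M, \<nu>))" "X \<in> Obj C" "(M, \<nu>) \<in> Obj Mod"
      by (cases P) (auto simp: prod_cat_def)
    then show "obj_map act P \<in> Obj Mod" by simp
    show "arr_map act (Ident (prod_cat C Mod) P) = Ident Mod (obj_map act P)"
      using P Mod_ObjD[OF P(3)] by (simp add: prod_cat_def act_simps)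
  next
    fix p P Q assume "p \<in> Hom (prod_cat C Mod) P Q"
    then show "arr_map act p \<in> Hom Mod (obj_map act P) (obj_map act Q)"
      using act_hom_Mod by (cases p; cases P; cases Q) (simp add: Hom_prod_cat)
  next
    fix p q P Q R
    assume pq: "p \<in> Hom (prod_cat C Mod) P Q" "q \<in> Hom (prod_cat C Mod) Q R"
    obtain X L where P: "P = (X, L)" by (cases P)
    obtain Y M where Q: "Q = (Y, M)" by (cases Q)
    obtain Z N where R: "R = (Z, N)" by (cases R)
    obtain f k where p: "p = (f, k)" by (cases p)
    obtain g h where q: "q = (g, h)" by (cases q)
    note e = P Q R p q
    have f: "f \<in> Hom C X Y" "g \<in> Hom C Y Z" and k: "k \<in> Hom Mod L M" "h \<in> Hom Mod M N"
      using pq by (auto simp: e Hom_prod_cat)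
    have k': "source k = L" "target k = M" "source h = M" "target h = N"
      "cell k \<in> cells2 K" "cell h \<in> cells2 K" "dom2 K (cell h) = cod2 K (cell k)"
      "trg K (dom2 K (cell k)) = A"
      using k by (cases L; cases M; cases N; auto simp: Mod_Hom_iff Mod_ObjD)+
    show "arr_map act (q \<circ>\<^bsub>prod_cat C Mod\<^esub> p) = arr_map act q \<circ>\<^bsub>Mod\<^esub> arr_map act p"
      using k' HomD_C[OF f(1)] HomD_C[OF f(2)] HomD_C[OF C.comp_hom[OF f]]
      by (simp add: prod_cat_def e act_simps(2) carrier2_comp[OF f] interchange' carrier2_cell[OF f(1)]
        carrier2_cell[OF f(2)])
  qed
qed

text \<open>\<open>F\<close> sends the monoidal unit to \<open>(id1 K A, \<iota> B)\<close>, which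
  acts strictly as the identity on modules and on their morphisms. This is what allows the
  unity-action isomorphism to be the identity.\<close>

lemma unital_action_data: "unital_action_data C Mod act (Ident Mod)"
proof -
  interpret M: category Mod by (rule category_Mod)
  interpret act: is_functor "prod_cat C Mod" Mod act by (rule act_is_functor)
  have [simp]: "obj_map act (\<one>\<^bsub>C\<^esub>, M) = M" if "M \<in> Obj Mod" for M
    using that by (cases M) (auto simp: act_simps act_cell_def Mod_ObjD)
  show ?thesis
  proof
    fix M assume "M \<in> Obj Mod"
    then show "Ident Mod M \<in> isos Mod (obj_map act (\<one>\<^bsub>C\<^esub>, M)) M"
      using M.ident_hom[of M] M.comp_ident_left[of "Ident Mod M" M M] unfolding isos_def by force
  next
    fix k M N assume k: "k \<in> Hom Mod M N"
    obtain M0 \<nu> N0 \<nu>' where M: "M = (M0, \<nu>)" "N = (N0, \<nu>')" by fastforce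
    have "arr_map act (Ident C \<one>\<^bsub>C\<^esub>, k) = k"
      using k by (auto simp: M act_simps(2) Mod_Hom_iff Mod_ObjD)
    then show "Ident Mod N \<circ>\<^bsub>Mod\<^esub> arr_map act (Ident C \<one>\<^bsub>C\<^esub>, k) = k \<circ>\<^bsub>Mod\<^esub> Ident Mod M"
      using M.comp_ident_left[OF k] M.comp_ident_right[OF k] by simp
  qed
qed

text \<open>\<open>F\<close> preserves tensor products strictly, so the twist of a tensor product is
  the composite of the two twists, and acting in two stages gives literally the same module. Source
  and target of an associativity constraint therefore coincide.\<close>

lemma act_assoc_obj:
  assumes "X \<in> Obj C" "Y \<in> Obj C" "M \<in> Obj Mod"
  shows "obj_map act (X, obj_map act (Y, M)) = obj_map act (X \<otimes>\<^bsub>C\<^esub> Y, M)"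
proof (cases M)
  case (Pair M0 \<nu>)
  then show ?thesis
    using assms Mod_ObjD[of M0 \<nu>] by (simp add: act_simps act_cell_def)
qed

text \<open>Both modules equal the one obtained by acting three times in succession, although the
  two bracketings may be distinct objects of \<open>C\<close>.\<close>

lemma act_tens_assoc_obj:
  assumes "X \<in> Obj C" "Y \<in> Obj C" "Z \<in> Obj C" "M \<in> Obj Mod"
  shows "obj_map act ((X \<otimes>\<^bsub>C\<^esub> Y) \<otimes>\<^bsub>C\<^esub> Z, M) = obj_map act (X \<otimes>\<^bsub>C\<^esub> (Y \<otimes>\<^bsub>C\<^esub> Z), M)"
  using assms by (simp flip: act_assoc_obj)

lemma act_assoc_arr:
  assumes f: "f \<in> Hom C X X'" and g: "g \<in> Hom C Y Y'" and k: "k \<in> Hom Mod M M'"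
  shows "arr_map act (f, arr_map act (g, k)) = arr_map act (f \<boxtimes>\<^bsub>C\<^esub> g, k)"
proof -
  have k': "source k = M" "target k = M'" "cell k \<in> cells2 K" "trg K (dom2 K (cell k)) = A"
     "M \<in> Obj Mod" "M' \<in> Obj Mod"
    using k by (cases M; cases M'; auto simp: Mod_Hom_iff Mod_ObjD)+
  show ?thesis
    using k' HomD_C[OF f] HomD_C[OF g] HomD_C[OF tens_hom[OF f g]]
    by (simp add: act_simps(2) act_assoc_obj carrier2_tens carrier2_cell[OF f] carrier2_cell[OF g])
qed

section \<open>Coherence common to both orientations\<close>

abbreviation EM_op where "EM_op \<equiv> normalized_EM_operator K A B \<mu> \<eta> C F"

text \<open>The axioms for an associativity constraint that do not depend on its orientation.\<close>

definition coherent :: "('c \<Rightarrow> 'c \<Rightarrow> 'f \<times> 't \<Rightarrow> ('f \<times> 't, 't) arrow) \<Rightarrow> bool"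
  where "coherent r \<longleftrightarrow>
    (\<forall>X \<in> Obj C. \<forall>Y \<in> Obj C. \<forall>M \<in> Obj Mod.
      r X Y M \<in> isos Mod (obj_map act (X \<otimes>\<^bsub>C\<^esub> Y, M)) (obj_map act (X \<otimes>\<^bsub>C\<^esub> Y, M))) \<and>
    (\<forall>f g k X X' Y Y' M M'. f \<in> Hom C X X' \<longrightarrow> g \<in> Hom C Y Y' \<longrightarrow> k \<in> Hom Mod M M' \<longrightarrow>
      r X' Y' M' \<circ>\<^bsub>Mod\<^esub> arr_map act (f \<boxtimes>\<^bsub>C\<^esub> g, k) = arr_map act (f \<boxtimes>\<^bsub>C\<^esub> g, k) \<circ>\<^bsub>Mod\<^esub> r X Y M) \<and>
    (\<forall>X \<in> Obj C. \<forall>M \<in> Obj Mod.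
      r X \<one>\<^bsub>C\<^esub> M = Ident Mod (obj_map act (X, M)) \<and> r \<one>\<^bsub>C\<^esub> X M = Ident Mod (obj_map act (X, M)))"

lemma act_Ident:
  assumes "X \<in> Obj C" "M \<in> Obj Mod"
  shows "arr_map act (Ident C X, Ident Mod M) = Ident Mod (obj_map act (X, M))"
  using assms by (cases M) (simp add: act_simps Mod_ObjD)

text \<open>With identity unit constraints, the triangle axioms of both action locales take the form
  of a composite with an identity on the left. The identity may be dropped because the first
  conjunct makes the constraint at the unit an endomorphism of the acted module.\<close>

lemma coherent_iff:
  "coherent r \<longleftrightarrow>
    (\<forall>X \<in> Obj C. \<forall>Y \<in> Obj C. \<forall>M \<in> Obj Mod.
      r X Y M \<in> isos Mod (obj_map act (X \<otimes>\<^bsub>C\<^esub> Y, M)) (obj_map act (X \<otimes>\<^bsub>C\<^esub> Y, M))) \<and>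
    (\<forall>f g k X X' Y Y' M M'. f \<in> Hom C X X' \<longrightarrow> g \<in> Hom C Y Y' \<longrightarrow> k \<in> Hom Mod M M' \<longrightarrow>
      r X' Y' M' \<circ>\<^bsub>Mod\<^esub> arr_map act (f \<boxtimes>\<^bsub>C\<^esub> g, k) = arr_map act (f \<boxtimes>\<^bsub>C\<^esub> g, k) \<circ>\<^bsub>Mod\<^esub> r X Y M) \<and>
    (\<forall>X \<in> Obj C. \<forall>M \<in> Obj Mod.
      Ident Mod (obj_map act (X, M)) \<circ>\<^bsub>Mod\<^esub> r X \<one>\<^bsub>C\<^esub> M = Ident Mod (obj_map act (X, M)) \<and>
      Ident Mod (obj_map act (X, M)) \<circ>\<^bsub>Mod\<^esub> r \<one>\<^bsub>C\<^esub> X M = Ident Mod (obj_map act (X, M)))"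
proof -
  interpret M: category Mod by (rule category_Mod)
  have "Ident Mod (obj_map act (X, M)) \<circ>\<^bsub>Mod\<^esub> r X \<one>\<^bsub>C\<^esub> M = r X \<one>\<^bsub>C\<^esub> M \<and>
      Ident Mod (obj_map act (X, M)) \<circ>\<^bsub>Mod\<^esub> r \<one>\<^bsub>C\<^esub> X M = r \<one>\<^bsub>C\<^esub> X M"
    if "X \<in> Obj C" "M \<in> Obj Mod" and
      "\<forall>X \<in> Obj C. \<forall>Y \<in> Obj C. \<forall>M \<in> Obj Mod.
        r X Y M \<in> isos Mod (obj_map act (X \<otimes>\<^bsub>C\<^esub> Y, M)) (obj_map act (X \<otimes>\<^bsub>C\<^esub> Y, M))" for X M
  proof -
    have "r X \<one>\<^bsub>C\<^esub> M \<in> Hom Mod (obj_map act (X, M)) (obj_map act (X, M))"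
      "r \<one>\<^bsub>C\<^esub> X M \<in> Hom Mod (obj_map act (X, M)) (obj_map act (X, M))"
      using that(3)[rule_format, of X "\<one>\<^bsub>C\<^esub>" M] that(3)[rule_format, of "\<one>\<^bsub>C\<^esub>" X M] that(1,2)
      by (simp_all add: isos_def)
    then show ?thesis
      by (metis M.comp_ident_left)
  qed
  then show ?thesis
    unfolding coherent_def by (safe; metis)
qed

lemma monoidal_action_iff:
  "monoidal_action C Mod act (Ident Mod) r \<longleftrightarrow> coherent r \<and>
    (\<forall>X \<in> Obj C. \<forall>Y \<in> Obj C. \<forall>Z \<in> Obj C. \<forall>M \<in> Obj Mod.
      arr_map act (Ident C X, r Y Z M) \<circ>\<^bsub>Mod\<^esub> r X (Y \<otimes>\<^bsub>C\<^esub> Z) M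
          \<circ>\<^bsub>Mod\<^esub> arr_map act (assoc C X Y Z, Ident Mod M)
        = r X Y (obj_map act (Z, M)) \<circ>\<^bsub>Mod\<^esub> r (X \<otimes>\<^bsub>C\<^esub> Y) Z M)"
  unfolding monoidal_action_def monoidal_action_axioms_def coherent_iff
  \<comment> \<open>Without \<open>Mod_simps\<close> the composites of module maps stay folded and
    match the shape of \<open>coherent_iff\<close>.\<close>
  by (auto simp: unital_action_data act_assoc_obj act_assoc_arr act_Ident simp del: Mod_simps)

lemma monoidal_action_inverse_form_iff:
  "monoidal_action_inverse_form C Mod act (Ident Mod) r \<longleftrightarrow> coherent r \<and>
    (\<forall>X \<in> Obj C. \<forall>Y \<in> Obj C. \<forall>Z \<in> Obj C. \<forall>M \<in> Obj Mod.
      arr_map act (assoc C X Y Z, Ident Mod M) \<circ>\<^bsub>Mod\<^esub> r (X \<otimes>\<^bsub>C\<^esub> Y) Z M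
          \<circ>\<^bsub>Mod\<^esub> r X Y (obj_map act (Z, M))
        = r X (Y \<otimes>\<^bsub>C\<^esub> Z) M \<circ>\<^bsub>Mod\<^esub> arr_map act (Ident C X, r Y Z M))"
  unfolding monoidal_action_inverse_form_def monoidal_action_inverse_form_axioms_def coherent_iff
  by (auto simp: unital_action_data act_assoc_obj act_assoc_arr act_Ident simp del: Mod_simps)

section \<open>Passage between operators on \<open>C\<close> and associativity constraints\<close>

definition induced_assoc :: "('c \<Rightarrow> 'c \<Rightarrow> ('f \<times> 't, 't) arrow)
    \<Rightarrow> 'c \<Rightarrow> 'c \<Rightarrow> 'f \<times> 't \<Rightarrow> ('f \<times> 't, 't) arrow"
  where "induced_assoc \<rho> X Y M = Arrow (obj_map act (X \<otimes>\<^bsub>C\<^esub> Y, M))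
    (induced (cr X \<cdot> cr Y) (cell (\<rho> X Y)) M) (obj_map act (X \<otimes>\<^bsub>C\<^esub> Y, M))"

lemma tens_twisted_obj_map:
  assumes "X \<in> Obj C" "Y \<in> Obj C"
  shows "tens_twisted K (obj_map F X) (obj_map F Y) = (cr X \<cdot> cr Y, tw (X \<otimes>\<^bsub>C\<^esub> Y))"
  using assms by (simp add: obj_map_eq tens_twisted_def)

lemma EM_op_pre:
  assumes "EM_op \<rho>" "X \<in> Obj C" "Y \<in> Obj C"
  shows "kleisli_cell (cr X \<cdot> cr Y) (cr X \<cdot> cr Y) (cell (\<rho> X Y))"
  using assms by (intro EM_HomD[of _ _ "tw (X \<otimes>\<^bsub>C\<^esub> Y)" _ "tw (X \<otimes>\<^bsub>C\<^esub> Y)"])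
    (auto simp: normalized_EM_operator_def tens_twisted_obj_map isos_def)

text \<open>By \<open>induced_regular\<close>, evaluating the regular component at the unit returns
  the cell of \<open>\<rho>\<close>; whiskering this by \<open>M\<close> reduces the determination
  formula to the definition of \<open>induced\<close>.\<close>

lemma determined_induced_assoc:
  assumes "EM_op \<rho>"
  shows "determined_by_regular K A B \<mu> \<eta> C F (induced_assoc \<rho>)"
proof -
  have "induced (cr X \<cdot> cr Y) (cell (\<rho> X Y)) (M, \<nu>) =
      (\<iota> (cr X \<cdot> cr Y) \<star> \<nu>) \<bullet> (induced (cr X \<cdot> cr Y) (cell (\<rho> X Y)) (B, \<mu>) \<star> \<iota> M) \<bullet>
      (\<iota> (cr X \<cdot> cr Y) \<star> \<eta> \<star> \<iota> M)"
    if "X \<in> Obj C" "Y \<in> Obj C" and M: "(M, \<nu>) \<in> Obj Mod" for X Y M \<nu>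
  proof -
    note pre = EM_op_pre[OF assms that(1,2)]
    have r: "(induced (cr X \<cdot> cr Y) (cell (\<rho> X Y)) (B, \<mu>) \<star> \<iota> M) \<bullet>
       (\<iota> (cr X \<cdot> cr Y) \<star> \<eta> \<star> \<iota> M) = cell (\<rho> X Y) \<star> \<iota> M"
      using whisker_eq(2)[OF induced_regular[OF pre], of M] that(1,2) Mod_ObjD[OF M]
        induced_cell[OF pre regular_module] by simp
    show ?thesis unfolding r by (simp add: induced_def)
  qed
  then show ?thesis
    by (auto simp: determined_by_regular_def Let_def induced_assoc_def)
qed

lemma coherent_induced_assoc:
  assumes "EM_op \<rho>"
  shows "coherent (induced_assoc \<rho>)"
  unfolding coherent_def
proof (intro conjI ballI allI impI)
  fix X Y M assume X: "X \<in> Obj C" "Y \<in> Obj C" and M: "M \<in> Obj Mod"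
  obtain M' \<nu> where e: "M = (M', \<nu>)" by (cases M)
  have "\<rho> X Y \<in> isos EM (cr X \<cdot> cr Y, tw (X \<otimes>\<^bsub>C\<^esub> Y)) (cr X \<cdot> cr Y, tw (X \<otimes>\<^bsub>C\<^esub> Y))"
    using assms X by (auto simp: normalized_EM_operator_def tens_twisted_obj_map)
  from induced_iso[OF this M[unfolded e]]
  show "induced_assoc \<rho> X Y M
      \<in> isos Mod (obj_map act (X \<otimes>\<^bsub>C\<^esub> Y, M)) (obj_map act (X \<otimes>\<^bsub>C\<^esub> Y, M))"
    using X by (simp add: induced_assoc_def act_simps(1) e)
next
  fix f g k X X' Y Y' M N
  assume f: "f \<in> Hom C X X'" and g: "g \<in> Hom C Y Y'" and k: "k \<in> Hom Mod M N"
  obtain M' \<nu> where M: "M = (M', \<nu>)" by (cases M)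
  obtain N' \<nu>' where N: "N = (N', \<nu>')" by (cases N)
  note fg = HomD_C[OF f] HomD_C[OF g] HomD_C[OF tens_hom[OF f g]]
    carrier2_cell[OF f] carrier2_cell[OF g]
  have k': "source k = M" "target k = N" "cell k \<in> cells2 K" "trg K (dom2 K (cell k)) = A"
     "dom2 K (cell k) = M'" "cod2 K (cell k) = N'" and Mod: "(M', \<nu>) \<in> Obj Mod" "(N', \<nu>') \<in> Obj Mod"
    using k by (auto simp: Mod_Hom_iff Mod_ObjD M N)
  define \<beta> where "\<beta> = carrier2 F f \<star> carrier2 F g"
  have b: "\<beta> \<in> cells2 K" "dom2 K \<beta> = cr X \<cdot> cr Y" "cod2 K \<beta> = cr X' \<cdot> cr Y'"
    using fg by (simp_all add: \<beta>_def)
  note pre = EM_op_pre[OF assms fg(4,9)] and pre' = EM_op_pre[OF assms fg(5,10)]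
  have "(carrier2 F f \<star> carrier2 F g \<star> \<iota> B) \<bullet> cell (\<rho> X Y) = cell (\<rho> X' Y') \<bullet> \<beta>"
    using assms fg unfolding normalized_EM_operator_def \<beta>_def by metis
  then have nat: "(\<beta> \<star> \<iota> B) \<bullet> cell (\<rho> X Y) = cell (\<rho> X' Y') \<bullet> \<beta>"
    using fg by (simp add: \<beta>_def)
  have bk_hom: "\<beta> \<in> hom2 K (cr X \<cdot> cr Y) (cr X' \<cdot> cr Y')" "cell k \<in> hom2 K M' N'"
      "src K (cr X \<cdot> cr Y) = trg K M'"
    using b k' fg(4,9) Mod_ObjD[OF Mod(1)] by (simp_all add: hom2_def)
  \<comment> \<open>Naturality is split into the variable \<open>k\<close>, where linearity of the
    module map suffices (\<open>t1\<close>), and the pair \<open>f\<close>, \<open>g\<close>, where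
    naturality of \<open>\<rho>\<close> is needed (\<open>t2\<close>).\<close>
  note bk = hcomp_slices(2)[OF bk_hom]
  let ?r = "induced (cr X \<cdot> cr Y) (cell (\<rho> X Y))" and ?r' = "induced (cr X' \<cdot> cr Y') (cell (\<rho> X' Y'))"
  note cells = induced_cell[OF pre Mod(1)] induced_cell[OF pre Mod(2)] induced_cell[OF pre' Mod(1)]
    induced_cell[OF pre' Mod(2)] Mod_ObjD[OF Mod(1)] Mod_ObjD[OF Mod(2)]
  have t1: "?r' (N', \<nu>') \<bullet> (\<iota> (cr X' \<cdot> cr Y') \<star> cell k) = (\<iota> (cr X' \<cdot> cr Y') \<star> cell k) \<bullet> ?r' (M', \<nu>)"
    by (rule induced_natural[OF pre' k[unfolded M N]])
  have t2: "?r' (M', \<nu>) \<bullet> (\<beta> \<star> \<iota> M') = (\<beta> \<star> \<iota> M') \<bullet> ?r (M', \<nu>)"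
    using induced_precomp[OF pre' b(1,3) Mod(1)] induced_postcomp[OF pre b Mod(1)] nat by simp
  have "?r' (N', \<nu>') \<bullet> (\<beta> \<star> cell k) = (\<beta> \<star> cell k) \<bullet> ?r (M', \<nu>)"
    unfolding bk using b k' fg(4,5,9,10) cells
    by (simp add: vcomp_tail[OF t1] t2)
  then show "induced_assoc \<rho> X' Y' N \<circ>\<^bsub>Mod\<^esub> arr_map act (f \<boxtimes>\<^bsub>C\<^esub> g, k)
      = arr_map act (f \<boxtimes>\<^bsub>C\<^esub> g, k) \<circ>\<^bsub>Mod\<^esub> induced_assoc \<rho> X Y M"
    using fg k' by (simp add: induced_assoc_def act_simps(2) carrier2_tens M N flip: \<beta>_def)
next
  fix X M assume X: "X \<in> Obj C" and M: "M \<in> Obj Mod"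
  obtain M' \<nu> where e: "M = (M', \<nu>)" by (cases M)
  have "cell (\<rho> X \<one>\<^bsub>C\<^esub>) = \<iota> (cr X) \<star> \<eta>" "cell (\<rho> \<one>\<^bsub>C\<^esub> X) = \<iota> (cr X) \<star> \<eta>"
    using assms X by (auto simp: normalized_EM_operator_def)
  then show "induced_assoc \<rho> X \<one>\<^bsub>C\<^esub> M = Ident Mod (obj_map act (X, M))"
    "induced_assoc \<rho> \<one>\<^bsub>C\<^esub> X M = Ident Mod (obj_map act (X, M))"
    using X M by (simp_all add: induced_assoc_def induced_id e act_simps(1))
qed

text \<open>The converse passage: \<open>\<rho>\<close> is the regular component of \<open>r\<close>
  at the unit. Determination says precisely that \<open>r\<close> is induced by this
  \<open>\<rho>\<close>, so the properties of \<open>\<rho>\<close> can be read off on the regular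
  module.\<close>

lemma coherent_determined_induced:
  assumes "coherent r" "determined_by_regular K A B \<mu> \<eta> C F r"
  defines "\<rho> \<equiv> \<lambda>X Y. Arrow (cr X \<cdot> cr Y, tw (X \<otimes>\<^bsub>C\<^esub> Y))
    (cell (r X Y (B, \<mu>)) \<bullet> (\<iota> (cr X \<cdot> cr Y) \<star> \<eta>)) (cr X \<cdot> cr Y, tw (X \<otimes>\<^bsub>C\<^esub> Y))"
  shows "EM_op \<rho>"
    and "\<And>X Y M. X \<in> Obj C \<Longrightarrow> Y \<in> Obj C \<Longrightarrow> M \<in> Obj Mod \<Longrightarrow> r X Y M = induced_assoc \<rho> X Y M"
proof -
  have iso: "r X Y M \<in> isos Mod (obj_map act (X \<otimes>\<^bsub>C\<^esub> Y, M)) (obj_map act (X \<otimes>\<^bsub>C\<^esub> Y, M))"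
    if "X \<in> Obj C" "Y \<in> Obj C" "M \<in> Obj Mod" for X Y M
    using assms(1) that by (auto simp: coherent_def)
  have reg: "cell (r X Y (B, \<mu>)) \<in> cells2 K" "dom2 K (cell (r X Y (B, \<mu>))) = cr X \<cdot> cr Y \<cdot> B"
    "cod2 K (cell (r X Y (B, \<mu>))) = cr X \<cdot> cr Y \<cdot> B"
    if "X \<in> Obj C" "Y \<in> Obj C" for X Y
    using iso[OF that regular_module] that by (auto simp: isos_def act_simps(1) Mod_Hom_iff)
  have ind: "cell (r X Y (M, \<nu>)) = induced (cr X \<cdot> cr Y) (cell (\<rho> X Y)) (M, \<nu>)"
    if "X \<in> Obj C" "Y \<in> Obj C" "(M, \<nu>) \<in> Obj Mod" for X Y M \<nu>
  proof -
    have "cell (r X Y (M, \<nu>)) = (\<iota> (cr X \<cdot> cr Y) \<star> \<nu>) \<bullet> (cell (r X Y (B, \<mu>)) \<star> \<iota> M) \<bullet>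
        (\<iota> (cr X \<cdot> cr Y) \<star> \<eta> \<star> \<iota> M)"
      using bspec[OF bspec[OF bspec[OF assms(2)[unfolded determined_by_regular_def] that(1)] that(2)]
          that(3)]
      by (simp add: Let_def)
    then show ?thesis
      using that Mod_ObjD[OF that(3)] reg[OF that(1,2)] by (simp add: \<rho>_def induced_def)
  qed
  show r: "r X Y M = induced_assoc \<rho> X Y M" if XY: "X \<in> Obj C" "Y \<in> Obj C" and M: "M \<in> Obj Mod"
    for X Y M
  proof -
    \<comment> \<open>The determination formula concerns cells only; equality of arrows also needs
      the tags.\<close>
    have "source (r X Y M) = obj_map act (X \<otimes>\<^bsub>C\<^esub> Y, M)" "target (r X Y M) = obj_map act (X \<otimes>\<^bsub>C\<^esub> Y, M)"
      using iso[OF that] by (auto simp: isos_def Hom_def)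
    then show ?thesis
      using ind[OF XY, of "fst M" "snd M"] M by (auto simp: induced_assoc_def intro: arrow.expand)
  qed
  show "EM_op \<rho>"
    unfolding normalized_EM_operator_def
  proof (intro conjI ballI)
    fix X Y assume XY: "X \<in> Obj C" "Y \<in> Obj C"
    have "\<rho> X Y \<in> isos EM (cr X \<cdot> cr Y, tw (X \<otimes>\<^bsub>C\<^esub> Y)) (cr X \<cdot> cr Y, tw (X \<otimes>\<^bsub>C\<^esub> Y))"
      unfolding \<rho>_def
    proof (rule EM_iso_of_regular)
      show "(cr X \<cdot> cr Y, tw (X \<otimes>\<^bsub>C\<^esub> Y)) \<in> endos" "(cr X \<cdot> cr Y, tw (X \<otimes>\<^bsub>C\<^esub> Y)) \<in> endos"
        using twisted_endo[of "X \<otimes>\<^bsub>C\<^esub> Y"] XY by auto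
      show "r X Y (B, \<mu>) \<in> isos Mod ((cr X \<cdot> cr Y) \<cdot> B, act_cell (cr X \<cdot> cr Y, tw (X \<otimes>\<^bsub>C\<^esub> Y)) (B, \<mu>))
          ((cr X \<cdot> cr Y) \<cdot> B, act_cell (cr X \<cdot> cr Y, tw (X \<otimes>\<^bsub>C\<^esub> Y)) (B, \<mu>))"
        using iso[OF XY regular_module] XY by (simp add: act_simps(1))
      show "cell (r X Y (B, \<mu>)) =
          induced (cr X \<cdot> cr Y) (cell (r X Y (B, \<mu>)) \<bullet> (\<iota> (cr X \<cdot> cr Y) \<star> \<eta>)) (B, \<mu>)"
        using ind[OF XY regular_module] by (simp add: \<rho>_def)
    qed
    then show "\<rho> X Y \<in> isos EM (tens_twisted K (obj_map F X) (obj_map F Y))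
        (tens_twisted K (obj_map F X) (obj_map F Y))"
      using XY by (simp add: tens_twisted_obj_map)
  next
    fix f g assume "f \<in> Arr C" "g \<in> Arr C"
    then obtain X X' Y Y' where f: "f \<in> Hom C X X'" and g: "g \<in> Hom C Y Y'"
      by (auto simp: Hom_def)
    note fg = HomD_C[OF f] HomD_C[OF g] HomD_C[OF tens_hom[OF f g]]
      carrier2_cell[OF f] carrier2_cell[OF g]
    \<comment> \<open>Naturality of \<open>r\<close> is specialised to the identity of the regular
      module, so that only the objects of \<open>C\<close> vary.\<close>
    have "Ident Mod (B, \<mu>) \<in> Hom Mod (B, \<mu>) (B, \<mu>)"
      using category.ident_hom[OF category_Mod regular_module] .
    then have "r X' Y' (B, \<mu>) \<circ>\<^bsub>Mod\<^esub> arr_map act (f \<boxtimes>\<^bsub>C\<^esub> g, Ident Mod (B, \<mu>)) =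
        arr_map act (f \<boxtimes>\<^bsub>C\<^esub> g, Ident Mod (B, \<mu>)) \<circ>\<^bsub>Mod\<^esub> r X Y (B, \<mu>)"
      using f g assms(1) unfolding coherent_def by blast
    then have nat: "cell (r X' Y' (B, \<mu>)) \<bullet> (carrier2 F f \<star> carrier2 F g \<star> \<iota> B) =
        (carrier2 F f \<star> carrier2 F g \<star> \<iota> B) \<bullet> cell (r X Y (B, \<mu>))"
      using fg by (simp add: act_simps(2) carrier2_tens)
    define \<beta> where "\<beta> = carrier2 F f \<star> carrier2 F g"
    have b: "\<beta> \<in> cells2 K" "dom2 K \<beta> = cr X \<cdot> cr Y" "cod2 K \<beta> = cr X' \<cdot> cr Y'"
        "carrier2 F f \<star> carrier2 F g \<star> \<iota> B = \<beta> \<star> \<iota> B"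
      using fg by (simp_all add: \<beta>_def)
    \<comment> \<open>Sliding the unit past \<open>\<beta>\<close> turns naturality of
      \<open>r\<close> on the regular module into naturality of \<open>\<rho>\<close>.\<close>
    have s: "(\<beta> \<star> \<iota> B) \<bullet> (\<iota> (cr X \<cdot> cr Y) \<star> \<eta>) = (\<iota> (cr X' \<cdot> cr Y') \<star> \<eta>) \<bullet> (\<beta> \<star> \<iota> (id1 K A))"
      by (rule slide) (use b fg in \<open>auto simp: hom2_def\<close>)
    show "(carrier2 F f \<star> carrier2 F g \<star> \<iota> B) \<bullet> cell (\<rho> (Dom C f) (Dom C g)) =
        cell (\<rho> (Cod C f) (Cod C g)) \<bullet> (carrier2 F f \<star> carrier2 F g)"
      unfolding b(4) \<beta>_def[symmetric] using fg b(1-3) reg[OF fg(4,9)] reg[OF fg(5,10)] s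
      by (simp add: \<rho>_def vcomp_tail[OF nat[unfolded b(4), symmetric]])
  next
    fix X assume X: "X \<in> Obj C"
    have "r X \<one>\<^bsub>C\<^esub> (B, \<mu>) = Ident Mod (obj_map act (X, (B, \<mu>)))"
      "r \<one>\<^bsub>C\<^esub> X (B, \<mu>) = Ident Mod (obj_map act (X, (B, \<mu>)))"
      using assms(1) X regular_module by (auto simp: coherent_def simp del: Mod_simps)
    then show "cell (\<rho> X \<one>\<^bsub>C\<^esub>) = \<iota> (cr X) \<star> \<eta>" "cell (\<rho> \<one>\<^bsub>C\<^esub> X) = \<iota> (cr X) \<star> \<eta>"
      using X by (simp_all add: \<rho>_def act_simps(1))
  qed
qed

section \<open>The pentagon and the cocycle condition\<close>

lemma assoc_cell:
  assumes "X \<in> Obj C" "Y \<in> Obj C" "Z \<in> Obj C"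
  shows "assoc C X Y Z \<in> Hom C ((X \<otimes>\<^bsub>C\<^esub> Y) \<otimes>\<^bsub>C\<^esub> Z) (X \<otimes>\<^bsub>C\<^esub> (Y \<otimes>\<^bsub>C\<^esub> Z))"
    "carrier2 F (assoc C X Y Z) \<in> cells2 K"
    "dom2 K (carrier2 F (assoc C X Y Z)) = cr X \<cdot> cr Y \<cdot> cr Z"
    "cod2 K (carrier2 F (assoc C X Y Z)) = cr X \<cdot> cr Y \<cdot> cr Z"
proof -
  show a: "assoc C X Y Z \<in> Hom C ((X \<otimes>\<^bsub>C\<^esub> Y) \<otimes>\<^bsub>C\<^esub> Z) (X \<otimes>\<^bsub>C\<^esub> (Y \<otimes>\<^bsub>C\<^esub> Z))"
    using C.assoc_iso[OF assms] by (simp add: isos_def)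
  show "carrier2 F (assoc C X Y Z) \<in> cells2 K"
    "dom2 K (carrier2 F (assoc C X Y Z)) = cr X \<cdot> cr Y \<cdot> cr Z"
    "cod2 K (carrier2 F (assoc C X Y Z)) = cr X \<cdot> cr Y \<cdot> cr Z"
    using carrier2_cell[OF a] assms by simp_all
qed

text \<open>Injectivity on the regular module, stated with a quantifier over all modules so that it
  matches the pentagon axiom.\<close>

lemma EM_eq_iff:
  assumes "kleisli_cell X Y \<sigma>" "kleisli_cell X Y \<sigma>'"
  shows "\<sigma> = \<sigma>' \<longleftrightarrow> (\<forall>M \<in> Obj Mod. induced Y \<sigma> M = induced Y \<sigma>' M)"
  using EM_eqI[OF assms] regular_module by auto

context
  fixes \<rho> :: "'c \<Rightarrow> 'c \<Rightarrow> ('f \<times> 't, 't) arrow" and X Y Z :: 'c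
  assumes op: "EM_op \<rho>" and objs: "X \<in> Obj C" "Y \<in> Obj C" "Z \<in> Obj C"
begin

private abbreviation XYZ where "XYZ \<equiv> cr X \<cdot> cr Y \<cdot> cr Z"
private abbreviation \<alpha> where "\<alpha> \<equiv> carrier2 F (assoc C X Y Z)"
text \<open>\<open>left\<close> and \<open>right\<close> are the Eilenberg-Moore whiskerings of
  \<open>\<rho>\<close> by \<open>X\<close> on the left and by \<open>Z\<close> with its twist on
  the right; \<open>outer\<close> and \<open>inner\<close> are the values of \<open>\<rho>\<close>
  at the bracketed pairs.\<close>

private abbreviation left where "left \<equiv> \<iota> (cr X) \<star> cell (\<rho> Y Z)"
private abbreviation right where
  "right \<equiv> (\<iota> (cr X \<cdot> cr Y) \<star> tw Z) \<bullet> (cell (\<rho> X Y) \<star> \<iota> (cr Z))"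
private abbreviation outer where "outer \<equiv> cell (\<rho> X (Y \<otimes>\<^bsub>C\<^esub> Z))"
private abbreviation inner where "inner \<equiv> cell (\<rho> (X \<otimes>\<^bsub>C\<^esub> Y) Z)"

lemma cocycle_cells:
  "kleisli_cell (cr X \<cdot> cr Y) (cr X \<cdot> cr Y) (cell (\<rho> X Y))"
  "kleisli_cell (cr Y \<cdot> cr Z) (cr Y \<cdot> cr Z) (cell (\<rho> Y Z))"
  "kleisli_cell XYZ XYZ left" "kleisli_cell XYZ XYZ right"
  "kleisli_cell XYZ XYZ outer" "kleisli_cell XYZ XYZ inner"
  "kleisli_cell XYZ XYZ (outer \<bullet> \<alpha>)"
proof -
  note ps = EM_op_pre[OF op objs(1,2)] EM_op_pre[OF op objs(2,3)]
    EM_op_pre[OF op objs(1) tens_closed[OF objs(2,3)]]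
    EM_op_pre[OF op tens_closed[OF objs(1,2)] objs(3)]
  show "kleisli_cell (cr X \<cdot> cr Y) (cr X \<cdot> cr Y) (cell (\<rho> X Y))"
    "kleisli_cell (cr Y \<cdot> cr Z) (cr Y \<cdot> cr Z) (cell (\<rho> Y Z))"
    "kleisli_cell XYZ XYZ left" "kleisli_cell XYZ XYZ right"
    "kleisli_cell XYZ XYZ outer" "kleisli_cell XYZ XYZ inner"
    "kleisli_cell XYZ XYZ (outer \<bullet> \<alpha>)"
    using ps objs assoc_cell[OF objs] by (simp_all add: kleisli_cell_def)
qed

text \<open>The dictionary for the edges of the pentagon: four of them are induced by
  Eilenberg-Moore 2-cells, two of these through the whiskering lemmas, and the fifth is the
  whiskered image of the associativity constraint of \<open>C\<close>.\<close>

lemma induced_assoc_cells: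
  assumes "M \<in> Obj Mod"
  shows "cell (arr_map act (Ident C X, induced_assoc \<rho> Y Z M)) = induced XYZ left M"
    "cell (induced_assoc \<rho> X (Y \<otimes>\<^bsub>C\<^esub> Z) M) = induced XYZ outer M"
    "cell (induced_assoc \<rho> (X \<otimes>\<^bsub>C\<^esub> Y) Z M) = induced XYZ inner M"
    "cell (induced_assoc \<rho> X Y (obj_map act (Z, M))) = induced XYZ right M"
    "cell (arr_map act (assoc C X Y Z, Ident Mod M)) = \<alpha> \<star> \<iota> (fst M)"
  using assms objs induced_whisker_left[OF cocycle_cells(2), of "cr X" "fst M" "snd M"]
    induced_whisker_right[OF cocycle_cells(1) twisted_endo[OF objs(3)], of "fst M" "snd M"]
  by (cases M; simp add: act_simps induced_assoc_def)+

text \<open>Each path around the pentagon is induced by one Eilenberg-Moore composite, since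
  \<open>induced\<close> respects composition and absorbs \<open>\<alpha>\<close> by precomposition.
  Equality on all modules is then equality of the composites, which is the cocycle
  condition.\<close>

lemma pentagon_iff_cocycle:
  "(\<forall>M \<in> Obj Mod. arr_map act (Ident C X, induced_assoc \<rho> Y Z M)
        \<circ>\<^bsub>Mod\<^esub> induced_assoc \<rho> X (Y \<otimes>\<^bsub>C\<^esub> Z) M
        \<circ>\<^bsub>Mod\<^esub> arr_map act (assoc C X Y Z, Ident Mod M)
      = induced_assoc \<rho> X Y (obj_map act (Z, M)) \<circ>\<^bsub>Mod\<^esub> induced_assoc \<rho> (X \<otimes>\<^bsub>C\<^esub> Y) Z M)
    \<longleftrightarrow> (\<iota> XYZ \<star> \<mu>) \<bullet> (\<iota> (cr X) \<star> cell (\<rho> Y Z) \<star> \<iota> B) \<bullet> outer \<bullet> \<alpha>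
      = (\<iota> XYZ \<star> \<mu>) \<bullet> (\<iota> (cr X \<cdot> cr Y) \<star> tw Z \<star> \<iota> B) \<bullet> (cell (\<rho> X Y) \<star> \<iota> (cr Z) \<star> \<iota> B) \<bullet> inner"
    (is "?pentagon \<longleftrightarrow> ?cocycle")
proof -
  have "?pentagon \<longleftrightarrow> (\<forall>M \<in> Obj Mod.
      induced XYZ (EM_vcomp XYZ left (outer \<bullet> \<alpha>)) M = induced XYZ (EM_vcomp XYZ right inner) M)"
  proof (intro ball_cong refl)
    fix M assume M: "M \<in> Obj Mod"
    obtain M' \<nu> where e: "M = (M', \<nu>)" by (cases M)
    note M' = M[unfolded e]
    show "(arr_map act (Ident C X, induced_assoc \<rho> Y Z M) \<circ>\<^bsub>Mod\<^esub> induced_assoc \<rho> X (Y \<otimes>\<^bsub>C\<^esub> Z) M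
        \<circ>\<^bsub>Mod\<^esub> arr_map act (assoc C X Y Z, Ident Mod M)
      = induced_assoc \<rho> X Y (obj_map act (Z, M)) \<circ>\<^bsub>Mod\<^esub> induced_assoc \<rho> (X \<otimes>\<^bsub>C\<^esub> Y) Z M) \<longleftrightarrow>
      induced XYZ (EM_vcomp XYZ left (outer \<bullet> \<alpha>)) M = induced XYZ (EM_vcomp XYZ right inner) M"
      using M induced_assoc_cells[OF M] induced_vcomp[OF cocycle_cells(7,3) M']
        induced_vcomp[OF cocycle_cells(6,4) M']
        induced_precomp[OF cocycle_cells(5) assoc_cell(2,4)[OF objs] M'] objs
        HomD_C[OF assoc_cell(1)[OF objs]]
      \<comment> \<open>The first call compares the underlying cells; the second settles the source
        and target tags, where the two bracketings must be identified.\<close>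
      by (simp add: e act_assoc_obj)
        (simp add: act_simps(2) induced_assoc_def act_assoc_obj act_tens_assoc_obj)
  qed
  also have "\<dots> \<longleftrightarrow> EM_vcomp XYZ left (outer \<bullet> \<alpha>) = EM_vcomp XYZ right inner"
    by (rule EM_eq_iff[OF kleisli_cell_vcomp[OF cocycle_cells(7,3)]
      kleisli_cell_vcomp[OF cocycle_cells(6,4)], symmetric])
  also have "\<dots> \<longleftrightarrow> ?cocycle"
    using cocycle_cells objs by (simp add: EM_vcomp_def kleisli_cell_def)
  finally show ?thesis .
qed

text \<open>The paths run in the opposite direction, so the composites are formed in reverse order
  and \<open>\<alpha>\<close> now comes last, absorbed by \<open>induced_postcomp\<close>.\<close>

lemma pentagon_iff_cocycle_inverse_form:
  "(\<forall>M \<in> Obj Mod. arr_map act (assoc C X Y Z, Ident Mod M)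
        \<circ>\<^bsub>Mod\<^esub> induced_assoc \<rho> (X \<otimes>\<^bsub>C\<^esub> Y) Z M \<circ>\<^bsub>Mod\<^esub> induced_assoc \<rho> X Y (obj_map act (Z, M))
      = induced_assoc \<rho> X (Y \<otimes>\<^bsub>C\<^esub> Z) M \<circ>\<^bsub>Mod\<^esub> arr_map act (Ident C X, induced_assoc \<rho> Y Z M))
    \<longleftrightarrow> (\<alpha> \<star> \<mu>) \<bullet> (inner \<star> \<iota> B) \<bullet> (\<iota> (cr X \<cdot> cr Y) \<star> tw Z) \<bullet> (cell (\<rho> X Y) \<star> \<iota> (cr Z))
      = (\<iota> XYZ \<star> \<mu>) \<bullet> (outer \<star> \<iota> B) \<bullet> (\<iota> (cr X) \<star> cell (\<rho> Y Z))"
    (is "?pentagon \<longleftrightarrow> ?cocycle")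
proof -
  have vc: "kleisli_cell XYZ XYZ (EM_vcomp XYZ inner right)"
    by (rule kleisli_cell_vcomp[OF cocycle_cells(4,6)])
  have pre: "kleisli_cell XYZ XYZ ((\<alpha> \<star> \<iota> B) \<bullet> EM_vcomp XYZ inner right)"
    using vc assoc_cell(2-4)[OF objs] by (simp add: kleisli_cell_def)
  have "?pentagon \<longleftrightarrow> (\<forall>M \<in> Obj Mod.
      induced XYZ ((\<alpha> \<star> \<iota> B) \<bullet> EM_vcomp XYZ inner right) M = induced XYZ (EM_vcomp XYZ outer left) M)"
  proof (intro ball_cong refl)
    fix M assume M: "M \<in> Obj Mod"
    obtain M' \<nu> where e: "M = (M', \<nu>)" by (cases M)
    note M' = M[unfolded e]
    show "(arr_map act (assoc C X Y Z, Ident Mod M)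
        \<circ>\<^bsub>Mod\<^esub> induced_assoc \<rho> (X \<otimes>\<^bsub>C\<^esub> Y) Z M \<circ>\<^bsub>Mod\<^esub> induced_assoc \<rho> X Y (obj_map act (Z, M))
      = induced_assoc \<rho> X (Y \<otimes>\<^bsub>C\<^esub> Z) M \<circ>\<^bsub>Mod\<^esub> arr_map act (Ident C X, induced_assoc \<rho> Y Z M)) \<longleftrightarrow>
      induced XYZ ((\<alpha> \<star> \<iota> B) \<bullet> EM_vcomp XYZ inner right) M = induced XYZ (EM_vcomp XYZ outer left) M"
      using M induced_assoc_cells[OF M] induced_vcomp[OF cocycle_cells(4,6) M']
        induced_vcomp[OF cocycle_cells(3,5) M']
        induced_postcomp[OF vc assoc_cell(2-4)[OF objs] M'] objs
        HomD_C[OF assoc_cell(1)[OF objs]]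
      by (simp add: e act_assoc_obj)
        (simp add: act_simps(2) induced_assoc_def act_assoc_obj act_tens_assoc_obj)
  qed
  also have "\<dots> \<longleftrightarrow> (\<alpha> \<star> \<iota> B) \<bullet> EM_vcomp XYZ inner right = EM_vcomp XYZ outer left"
    by (rule EM_eq_iff[OF pre kleisli_cell_vcomp[OF cocycle_cells(3,5)], symmetric])
  also have "\<dots> \<longleftrightarrow> ?cocycle"
  proof -
    \<comment> \<open>Splitting \<open>\<alpha> \<star> \<mu>\<close> with the multiplication first
      isolates the Eilenberg-Moore composite to which \<open>\<alpha>\<close> is applied.\<close>
    have "\<alpha> \<star> \<mu> = (\<alpha> \<star> \<iota> B) \<bullet> (\<iota> XYZ \<star> \<mu>)"
      by (rule hcomp_slices) (use assoc_cell(2-4)[OF objs] objs in \<open>auto simp: hom2_def\<close>)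
    then show ?thesis
      using cocycle_cells objs assoc_cell(2-4)[OF objs] by (simp add: EM_vcomp_def kleisli_cell_def)
  qed
  finally show ?thesis .
qed

end

section \<open>The equivalence for each orientation\<close>

lemma monoidal_action_iff_cocycle:
  "(\<exists>r. monoidal_action C Mod act (Ident Mod) r \<and> determined_by_regular K A B \<mu> \<eta> C F r)
    \<longleftrightarrow> (\<exists>\<rho>. EM_op \<rho> \<and> EM_cocycle K B \<mu> C F \<rho>)"
proof
  assume "\<exists>r. monoidal_action C Mod act (Ident Mod) r \<and> determined_by_regular K A B \<mu> \<eta> C F r"
  then obtain r where r: "monoidal_action C Mod act (Ident Mod) r"
    "determined_by_regular K A B \<mu> \<eta> C F r" by blast
  have "coherent r"
    using r(1) by (simp add: monoidal_action_iff)
  from coherent_determined_induced[OF this r(2)]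
  obtain \<rho> where \<rho>: "EM_op \<rho>" "\<And>X Y M. X \<in> Obj C \<Longrightarrow> Y \<in> Obj C \<Longrightarrow> M \<in> Obj Mod \<Longrightarrow>
      r X Y M = induced_assoc \<rho> X Y M"
    by blast
  have "EM_cocycle K B \<mu> C F \<rho>"
    unfolding EM_cocycle_def Let_def
    \<comment> \<open>Since \<open>r\<close> agrees with the constraint induced by
      \<open>\<rho>\<close> on all objects and modules, its pentagon is the one that the equivalence
      refers to.\<close>
    by (intro ballI, rule pentagon_iff_cocycle[OF \<rho>(1), THEN iffD1])
      (use r(1) in \<open>simp_all add: monoidal_action_iff \<rho>(2) del: Mod_simps\<close>)
  then show "\<exists>\<rho>. EM_op \<rho> \<and> EM_cocycle K B \<mu> C F \<rho>" using \<rho> by blast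
next
  assume "\<exists>\<rho>. EM_op \<rho> \<and> EM_cocycle K B \<mu> C F \<rho>"
  then obtain \<rho> where \<rho>: "EM_op \<rho>" "EM_cocycle K B \<mu> C F \<rho>" by blast
  have "monoidal_action C Mod act (Ident Mod) (induced_assoc \<rho>)"
    using \<rho>(2) unfolding EM_cocycle_def Let_def monoidal_action_iff
    using coherent_induced_assoc[OF \<rho>(1)] pentagon_iff_cocycle[OF \<rho>(1)] by blast
  then show "\<exists>r. monoidal_action C Mod act (Ident Mod) r \<and> determined_by_regular K A B \<mu> \<eta> C F r"
    using determined_induced_assoc[OF \<rho>(1)] by blast
qed

lemma monoidal_action_inverse_form_iff_cocycle:
  "(\<exists>r. monoidal_action_inverse_form C Mod act (Ident Mod) r \<and> determined_by_regular K A B \<mu> \<eta> C F r)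
    \<longleftrightarrow> (\<exists>\<rho>. EM_op \<rho> \<and> EM_cocycle_inverse_form K B \<mu> C F \<rho>)"
proof
  assume "\<exists>r. monoidal_action_inverse_form C Mod act (Ident Mod) r \<and> determined_by_regular K A B \<mu> \<eta> C F r"
  then obtain r where r: "monoidal_action_inverse_form C Mod act (Ident Mod) r"
    "determined_by_regular K A B \<mu> \<eta> C F r" by blast
  have "coherent r"
    using r(1) by (simp add: monoidal_action_inverse_form_iff)
  from coherent_determined_induced[OF this r(2)]
  obtain \<rho> where \<rho>: "EM_op \<rho>" "\<And>X Y M. X \<in> Obj C \<Longrightarrow> Y \<in> Obj C \<Longrightarrow> M \<in> Obj Mod \<Longrightarrow>
      r X Y M = induced_assoc \<rho> X Y M"
    by blast
  have "EM_cocycle_inverse_form K B \<mu> C F \<rho>"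
    unfolding EM_cocycle_inverse_form_def Let_def
    by (intro ballI, rule pentagon_iff_cocycle_inverse_form[OF \<rho>(1), THEN iffD1])
      (use r(1) in \<open>simp_all add: monoidal_action_inverse_form_iff \<rho>(2) del: Mod_simps\<close>)
  then show "\<exists>\<rho>. EM_op \<rho> \<and> EM_cocycle_inverse_form K B \<mu> C F \<rho>" using \<rho> by blast
next
  assume "\<exists>\<rho>. EM_op \<rho> \<and> EM_cocycle_inverse_form K B \<mu> C F \<rho>"
  then obtain \<rho> where \<rho>: "EM_op \<rho>" "EM_cocycle_inverse_form K B \<mu> C F \<rho>" by blast
  have "monoidal_action_inverse_form C Mod act (Ident Mod) (induced_assoc \<rho>)"
    using \<rho>(2) unfolding EM_cocycle_inverse_form_def Let_def monoidal_action_inverse_form_iff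
    using coherent_induced_assoc[OF \<rho>(1)] pentagon_iff_cocycle_inverse_form[OF \<rho>(1)] by blast
  then show "\<exists>r. monoidal_action_inverse_form C Mod act (Ident Mod) r \<and> determined_by_regular K A B \<mu> \<eta> C F r"
    using determined_induced_assoc[OF \<rho>(1)] by blast
qed

end

theorem theorem4p1:
  fixes K :: "('o, 'f, 't) two_cat"
    and A :: 'o and B :: 'f and \<mu> \<eta> :: 't
    and C :: "('c, 'm) moncat"
    and U F :: "('c, 'm, 'f \<times> 't, ('f \<times> 't, 't) arrow) fctr"
  assumes "two_category K"
    and "monad_in K A B \<mu> \<eta>"
    and "monoidal_category C"
    and "identity_unit_constraints C"
    and "quasi_monoidal_functor C (T_cat K A B \<mu> \<eta>) U"
    and "faithful C U"
    and "quasi_monoidal_functor C (T_cat K A B \<mu> \<eta>) F"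
    and "factors_through C F U"
  shows
    "((\<exists>r. monoidal_action C (modules_cat K A B \<mu> \<eta>) (module_act K C F)
             (Ident (modules_cat K A B \<mu> \<eta>)) r
           \<and> determined_by_regular K A B \<mu> \<eta> C F r)
      \<longleftrightarrow>
      (\<exists>\<rho>. normalized_EM_operator K A B \<mu> \<eta> C F \<rho> \<and> EM_cocycle K B \<mu> C F \<rho>))
     \<and>
     ((\<exists>\<rho>. monoidal_action_inverse_form C (modules_cat K A B \<mu> \<eta>) (module_act K C F)
             (Ident (modules_cat K A B \<mu> \<eta>)) \<rho>
           \<and> determined_by_regular K A B \<mu> \<eta> C F \<rho>)
      \<longleftrightarrow>
      (\<exists>\<rho>. normalized_EM_operator K A B \<mu> \<eta> C F \<rho> \<and> EM_cocycle_inverse_form K B \<mu> C F \<rho>))"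
proof -
  interpret lifted_objects K A B \<mu> \<eta> C F
    using assms by (intro lifted_objects.intro lifted_objects_axioms.intro)
  show ?thesis
    using monoidal_action_iff_cocycle monoidal_action_inverse_form_iff_cocycle by blast
qed

end
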